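(* There are $\Pi^0_1$ sets $P,Q\subseteq 2^{\mathbb N}$ such that $P^\frown Q<^1_1 P\cup Q<^1_1 P\oplus Q$.
   Context: For sets $A,B\subseteq\mathbb N^{\mathbb N}$, $A\le^1_1 B$ (Medvedev reducibility) means that there is a partial computable function $\Gamma:\subseteq\mathbb N^{\mathbb N}\to\mathbb N^{\mathbb N}$ defined on all of $B$ with $\Gamma(g)\in A$ for every $g\in B$; $A<^1_1B$ means $A\le^1_1B$ and $B\not\le^1_1A$. A set $P\subseteq 2^{\mathbb N}$ is $\Pi^0_1$ if $P=[T]$, the set of infinite paths of some computable tree $T\subseteq 2^{<\mathbb N}$. With each $\Pi^0_1$ set $P$ (given by an index) a corresponding computable tree $T_P\subseteq 2^{<\mathbb N}$ with $[T_P]=P$ is fixed; $L_P$ denotes the set of leaves (dead ends) of $T_P$, i.e. strings in $T_P$ with no proper extension in $T_P$. For a string $\rho$ and a set $Q$, $\rho^\frown Q=\{\rho^\frown f:f\in Q\}$. The (non-commutative) concatenation is $P^\frown Q=P\cup\bigcup_{\rho\in L_P}\rho^\frown Q$. Also $P\oplus Q=(\langle0\rangle^\frown P)\cup(\langle1\rangle^\frown Q)$. *)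

theory Defs
  imports "HOL-Library.Nat_Bijection" "HOL-Library.Omega_Words_Fun" "HOL-Library.Sublist"
begin

section \<open>Partial recursive functions with an oracle\<close>

text \<open>
  Kleene's schemes for partial recursive functions, extended by an oracle query. A program takes
  a list of arguments; it diverges on argument lists of the wrong shape.
\<close>

datatype prog =
    Zero
  | Succ
  | Proj nat
  | Oracle
  | Comp prog "prog list"
  | Prec prog prog
  | Mu prog

inductive eval :: "(nat \<Rightarrow> nat) \<Rightarrow> prog \<Rightarrow> nat list \<Rightarrow> nat \<Rightarrow> bool" for g :: "nat \<Rightarrow> nat" where
  eval_Zero: "eval g Zero xs 0"
| eval_Succ: "eval g Succ [x] (Suc x)"
| eval_Proj: "i < length xs \<Longrightarrow> eval g (Proj i) xs (xs ! i)"
| eval_Oracle: "eval g Oracle [x] (g x)"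
| eval_Comp:
    "length ys = length hs \<Longrightarrow> \<forall>i<length hs. eval g (hs ! i) xs (ys ! i) \<Longrightarrow> eval g f ys z
      \<Longrightarrow> eval g (Comp f hs) xs z"
| eval_Prec_0: "eval g f xs z \<Longrightarrow> eval g (Prec f h) (0 # xs) z"
| eval_Prec_Suc:
    "eval g (Prec f h) (n # xs) y \<Longrightarrow> eval g h (n # y # xs) z \<Longrightarrow> eval g (Prec f h) (Suc n # xs) z"
| eval_Mu:
    "eval g f (n # xs) 0 \<Longrightarrow> \<forall>m<n. \<exists>y. eval g f (m # xs) (Suc y) \<Longrightarrow> eval g (Mu f) xs n"

inductive_cases eval_ZeroE: "eval g Zero xs z"
inductive_cases eval_SuccE: "eval g Succ xs z"
inductive_cases eval_ProjE: "eval g (Proj i) xs z"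
inductive_cases eval_OracleE: "eval g Oracle xs z"
inductive_cases eval_CompE: "eval g (Comp f hs) xs z"
inductive_cases eval_Prec_0E: "eval g (Prec f h) (0 # xs) z"
inductive_cases eval_Prec_SucE: "eval g (Prec f h) (Suc n # xs) z"
inductive_cases eval_MuE: "eval g (Mu f) xs z"

lemma eval_deterministic: "eval g p xs y \<Longrightarrow> eval g p xs z \<Longrightarrow> y = z"
proof (induction arbitrary: z rule: eval.induct)
  case (eval_Zero xs)
  then show ?case by (elim eval_ZeroE) simp
next
  case (eval_Succ x)
  then show ?case by (elim eval_SuccE) simp
next
  case (eval_Proj i xs)
  from eval_Proj.prems show ?case by (elim eval_ProjE) simp
next
  case (eval_Oracle x)
  then show ?case by (elim eval_OracleE) simp
next
  case (eval_Comp ys hs xs f y z)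
  from eval_Comp.prems obtain ys' where
    ys': "length ys' = length hs" "\<forall>i<length hs. eval g (hs ! i) xs (ys' ! i)" "eval g f ys' z"
    by (elim eval_CompE) blast
  have "ys = ys'"
  proof (rule nth_equalityI)
    show "length ys = length ys'" using eval_Comp.hyps(1) ys'(1) by simp
  next
    fix i assume "i < length ys"
    then show "ys ! i = ys' ! i" using eval_Comp.hyps(1) eval_Comp.IH(1) ys'(2) by metis
  qed
  then show ?case using eval_Comp.IH(2) ys'(3) by metis
next
  case (eval_Prec_0 f xs y h)
  from eval_Prec_0.prems have "eval g f xs z" by (rule eval_Prec_0E)
  then show ?case by (rule eval_Prec_0.IH)
next
  case (eval_Prec_Suc f h n xs y z' z)
  from eval_Prec_Suc.prems obtain y' where
    y': "eval g (Prec f h) (n # xs) y'" "eval g h (n # y' # xs) z"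
    by (elim eval_Prec_SucE) blast
  from eval_Prec_Suc.IH(1)[OF y'(1)] y'(2) show ?case by (metis eval_Prec_Suc.IH(2))
next
  case (eval_Mu f n xs z)
  from eval_Mu.prems have z: "eval g f (z # xs) 0" "\<forall>m<z. \<exists>y. eval g f (m # xs) (Suc y)"
    by (elim eval_MuE; simp)+
  have "\<not> z < n" using eval_Mu.IH(2) z(1) by (metis nat.distinct(1))
  moreover have "\<not> n < z" using eval_Mu.IH(1) z(2) by (metis nat.distinct(1))
  ultimately show ?case by simp
qed

fun oracle_free :: "prog \<Rightarrow> bool" where
  "oracle_free Zero = True"
| "oracle_free Succ = True"
| "oracle_free (Proj i) = True"
| "oracle_free Oracle = False"
| "oracle_free (Comp f hs) = (oracle_free f \<and> (\<forall>h\<in>set hs. oracle_free h))"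
| "oracle_free (Prec f h) = (oracle_free f \<and> oracle_free h)"
| "oracle_free (Mu f) = oracle_free f"

text \<open>The oracle supplied here is irrelevant, because the program never queries it.\<close>

definition computable :: "(nat \<Rightarrow> nat) \<Rightarrow> bool" where
  "computable h \<longleftrightarrow> (\<exists>p. oracle_free p \<and> (\<forall>n. eval (\<lambda>_. 0) p [n] (h n)))"

text \<open>Strings are identified with numbers through the bijection \<^const>\<open>list_encode\<close>.\<close>

definition computable_strings :: "nat list set \<Rightarrow> bool" where
  "computable_strings T \<longleftrightarrow> computable (\<lambda>n. if list_decode n \<in> T then 1 else 0)"

definition partial_computable :: "((nat \<Rightarrow> nat) \<Rightarrow> (nat \<Rightarrow> nat) option) \<Rightarrow> bool" where
  "partial_computable \<Gamma> \<longleftrightarrow> (\<exists>p. \<forall>g f. \<Gamma> g = Some f \<longleftrightarrow> (\<forall>n. eval g p [n] (f n)))"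


section \<open>Medvedev reducibility\<close>

definition medvedev_le :: "(nat \<Rightarrow> nat) set \<Rightarrow> (nat \<Rightarrow> nat) set \<Rightarrow> bool"  (infix "\<le>\<^sub>M" 50) where
  "A \<le>\<^sub>M B \<longleftrightarrow> (\<exists>\<Gamma>. partial_computable \<Gamma> \<and> (\<forall>g\<in>B. \<exists>f\<in>A. \<Gamma> g = Some f))"

definition medvedev_less :: "(nat \<Rightarrow> nat) set \<Rightarrow> (nat \<Rightarrow> nat) set \<Rightarrow> bool"  (infix "<\<^sub>M" 50) where
  "A <\<^sub>M B \<longleftrightarrow> A \<le>\<^sub>M B \<and> \<not> B \<le>\<^sub>M A"


section \<open>$\Pi^0_1$ subsets of Cantor space\<close>

text \<open>
  Cantor space is the set of \<open>{0,1}\<close>-valued elements of Baire space. The prefix of length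
  \<open>n\<close> of an infinite sequence is \<^const>\<open>Omega_Words_Fun.prefix\<close>, whereas
  \<^const>\<open>Sublist.prefix\<close> is the prefix order on strings.
\<close>

definition computable_tree :: "nat list set \<Rightarrow> bool" where
  "computable_tree T \<longleftrightarrow>
     (\<forall>\<sigma>\<in>T. set \<sigma> \<subseteq> {0, 1}) \<and>
     (\<forall>\<sigma>\<in>T. \<forall>\<tau>. Sublist.prefix \<tau> \<sigma> \<longrightarrow> \<tau> \<in> T) \<and>
     computable_strings T"

definition paths :: "nat list set \<Rightarrow> (nat \<Rightarrow> nat) set" where
  "paths T = {f. \<forall>n. Omega_Words_Fun.prefix n f \<in> T}"

definition Pi01 :: "(nat \<Rightarrow> nat) set \<Rightarrow> bool" where
  "Pi01 P \<longleftrightarrow> (\<exists>T. computable_tree T \<and> P = paths T)"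

definition leaves :: "nat list set \<Rightarrow> nat list set" where
  "leaves T = {\<rho> \<in> T. \<not> (\<exists>\<tau>\<in>T. strict_prefix \<rho> \<tau>)}"

text \<open>
  The concatenation depends on the tree chosen for \<open>P\<close>, hence on the choice \<open>TP\<close> of a tree
  for each $\Pi^0_1$ set.
\<close>

definition concatenation ::
    "((nat \<Rightarrow> nat) set \<Rightarrow> nat list set) \<Rightarrow> (nat \<Rightarrow> nat) set \<Rightarrow> (nat \<Rightarrow> nat) set \<Rightarrow> (nat \<Rightarrow> nat) set" where
  "concatenation TP P Q = P \<union> (\<Union>\<rho>\<in>leaves (TP P). (\<lambda>f. \<rho> \<frown> f) ` Q)"

definition direct_sum ::
    "(nat \<Rightarrow> nat) set \<Rightarrow> (nat \<Rightarrow> nat) set \<Rightarrow> (nat \<Rightarrow> nat) set"  (infixl "\<oplus>" 65) where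
  "P \<oplus> Q = (\<lambda>f. [0] \<frown> f) ` P \<union> (\<lambda>f. [1] \<frown> f) ` Q"

end

(*
  Cut [1, oo) into the blocks [4^n, 4^(n+1)) and forbid, in a c.e. way, some contents of each block.
  P and Q consist of the sequences that avoid the forbidden contents of all blocks, except that
  each ignores one kind of blocks on which the other is diagonalised against it. For block n, each
  of the 2^(4^n) pasts contributes at most one forbidden content: a value that the n-th program
  outputs on a not too small fraction of the oracles. Later blocks forbid only a tiny fraction of
  all oracles, so some allowed oracle still outputs that value, and there is no injury.

  P + Q is not reducible to the union of P and Q: at a common point the reduction commits to P or
  to Q after reading a finite part of the oracle, and near that point neither class computes the
  other. The union is not reducible to the concatenation: every string in the tree of P extends to
  a member of the concatenation, so the outputs found on arbitrary strings of that tree can be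
  mixed, block by block, into a recursive sequence that avoids the forbidden contents of all blocks
  of kind 0, which is impossible. The concatenation is reducible to the union: follow g until it
  leaves the tree of P, then go to a leaf, which exists because P has no recursive member.
*)
theory Submission
  imports Complex_Main Defs
begin

section \<open>Programs\<close>

text \<open>The constants balance three quantities. Put q = 4^n. Block \<open>n\<close> has 2^(3q)
  contents, at most 2^q of them forbidden, a fraction of 2^-(2q). The next block then loses at most
  2^-(8q) of the oracles, and all later blocks together lose at most 2^-(5q). If a program answers
  on every allowed oracle, pigeonhole over 2^(3q) answers gives one with a fraction above 2^-(5q);
  conversely, an answer above that threshold is still given by some allowed oracle. The exponent 5
  sits between 3 and 8. Fractions are measured among all oracles, not among the allowed ones. Hence
  the forbidden contents of a block do not depend on other blocks, and they are c.e. without any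
  recursion between requirements. A content is forbidden whatever precedes the block, so all pasts
  are served at once, and a block must be long compared with its past. Blocks of kind 0 bind both
  classes and exclude recursive members; kinds 1 and 2 are those ignored by P and by Q.\<close>

lemma eval_oracle_free:
  assumes "eval g p xs y" "oracle_free p"
  shows "eval g' p xs y"
  using assms
proof (induction rule: eval.induct)
  case (eval_Comp ys hs xs f z)
  then show ?case by (auto intro!: eval.eval_Comp[of ys])
next
  case (eval_Mu f n xs)
  then show ?case by (auto intro!: eval.eval_Mu)
qed (auto intro: eval.intros)

section \<open>The use principle: a halting computation reads finitely much of its oracle\<close>

lemma finite_use:
  fixes P :: "nat \<Rightarrow> nat \<Rightarrow> bool"
  assumes "\<forall>i<n. \<exists>u. P i u" and mono: "\<And>i u u'. P i u \<Longrightarrow> u \<le> u' \<Longrightarrow> P i u'"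
  shows "\<exists>u. \<forall>i<n. P i u"
proof -
  obtain U where U: "\<forall>i<n. P i (U i)"
    using assms(1) by metis
  \<comment> \<open>The sum dominates every single \<open>U j\<close>, so it serves as a common
    bound.\<close>
  have "P i (\<Sum>j<n. U j)" if "i < n" for i
    using U that by (auto intro: mono[of i "U i"] member_le_sum)
  then show ?thesis by blast
qed

lemma eval_use:
  assumes "eval g p xs y"
  shows "\<exists>u. \<forall>g'. (\<forall>k<u. g' k = g k) \<longrightarrow> eval g' p xs y"
  using assms
proof (induction rule: eval.induct)
  case (eval_Oracle x)
  show ?case
    by (rule exI[of _ "Suc x"]) (metis eval.eval_Oracle lessI)
next
  case (eval_Comp ys hs xs f z)
  have "\<exists>u. \<forall>i<length hs. \<forall>g'. (\<forall>k<u. g' k = g k) \<longrightarrow> eval g' (hs ! i) xs (ys ! i)"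
    using eval_Comp.IH(1) by (intro finite_use) (auto dest: less_le_trans)
  then obtain u where u: "\<And>i g'. i < length hs \<Longrightarrow> \<forall>k<u. g' k = g k \<Longrightarrow> eval g' (hs ! i) xs (ys ! i)"
    by blast
  obtain u' where u': "\<And>g'. \<forall>k<u'. g' k = g k \<Longrightarrow> eval g' f ys z"
    using eval_Comp.IH(2) by blast
  show ?case
    by (rule exI[of _ "max u u'"]) (auto intro!: eval.eval_Comp[OF eval_Comp.hyps(1)] u u')
next
  case (eval_Prec_Suc f h n xs y z)
  then obtain u u' where u: "\<And>g'. \<forall>k<u. g' k = g k \<Longrightarrow> eval g' (Prec f h) (n # xs) y"
    and u': "\<And>g'. \<forall>k<u'. g' k = g k \<Longrightarrow> eval g' h (n # y # xs) z"
    by blast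
  show ?case
    by (rule exI[of _ "max u u'"]) (auto intro!: eval.eval_Prec_Suc[OF u u'])
next
  case (eval_Mu f n xs)
  have "\<exists>u. \<forall>m<n. \<exists>y. \<forall>g'. (\<forall>k<u. g' k = g k) \<longrightarrow> eval g' f (m # xs) (Suc y)"
  proof (rule finite_use)
    fix m u u'
    assume "\<exists>y. \<forall>g'. (\<forall>k<u. g' k = g k) \<longrightarrow> eval g' f (m # xs) (Suc y)" "u \<le> u'"
    then show "\<exists>y. \<forall>g'. (\<forall>k<u'. g' k = g k) \<longrightarrow> eval g' f (m # xs) (Suc y)"
      by (meson less_le_trans)
  qed (use eval_Mu.IH(2) in blast)
  then obtain u where u: "\<And>m. m < n \<Longrightarrow> \<exists>y. \<forall>g'. (\<forall>k<u. g' k = g k) \<longrightarrow> eval g' f (m # xs) (Suc y)"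
    by blast
  obtain u' where u': "\<And>g'. \<forall>k<u'. g' k = g k \<Longrightarrow> eval g' f (n # xs) 0"
    using eval_Mu.IH(1) by blast
  show ?case
  proof (rule exI[of _ "max u u'"], intro allI impI)
    fix g' assume g': "\<forall>k<max u u'. g' k = g k"
    have "\<exists>y. eval g' f (m # xs) (Suc y)" if "m < n" for m
      using u[OF that] g' by (meson max.strict_coboundedI1)
    moreover have "eval g' f (n # xs) 0"
      using g' by (intro u') auto
    ultimately show "eval g' (Mu f) xs n"
      by (simp add: eval.eval_Mu)
  qed
qed (auto intro: eval.intros)

section \<open>Composition of oracle programs\<close>

fun replace_oracle :: "prog \<Rightarrow> prog \<Rightarrow> prog" where
  "replace_oracle q Zero = Zero"
| "replace_oracle q Succ = Succ"
| "replace_oracle q (Proj i) = Proj i"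
| "replace_oracle q Oracle = q"
| "replace_oracle q (Comp f hs) = Comp (replace_oracle q f) (map (replace_oracle q) hs)"
| "replace_oracle q (Prec f h) = Prec (replace_oracle q f) (replace_oracle q h)"
| "replace_oracle q (Mu f) = Mu (replace_oracle q f)"

lemma eval_replace_oracle:
  assumes "eval f p xs y" "\<And>n. eval g q [n] (f n)"
  shows "eval g (replace_oracle q p) xs y"
  using assms
proof (induction rule: eval.induct)
  case (eval_Comp ys hs xs f z)
  then show ?case by (auto intro!: eval.eval_Comp[of ys])
next
  case (eval_Mu f n xs)
  then show ?case by (auto intro!: eval.eval_Mu)
qed (auto intro: eval.intros)

section \<open>Programs for arithmetic and the pairing function\<close>

lemma eval_Comp1: "eval g h xs y \<Longrightarrow> eval g f [y] z \<Longrightarrow> eval g (Comp f [h]) xs z"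
  by (rule eval_Comp[of "[y]"]) auto

lemma eval_Comp2:
  "eval g h1 xs y1 \<Longrightarrow> eval g h2 xs y2 \<Longrightarrow> eval g f [y1, y2] z \<Longrightarrow> eval g (Comp f [h1, h2]) xs z"
  by (rule eval_Comp[of "[y1, y2]"]) (auto simp: less_Suc_eq nth_Cons')

lemma eval_Proj_nth: "i < length xs \<Longrightarrow> y = xs ! i \<Longrightarrow> eval g (Proj i) xs y"
  by (simp add: eval_Proj)

lemma eval_Proj_simps:
  "eval g (Proj 0) (x # xs) x"
  "eval g (Proj 1) (x # y # xs) y"
  "eval g (Proj 2) (x # y # z # xs) z"
  by (simp_all add: eval_Proj_nth)

lemmas eval_rules = eval_Zero eval_Succ eval_Proj_simps eval_Comp1 eval_Comp2

definition const_prog :: "nat \<Rightarrow> prog" where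
  "const_prog k = ((\<lambda>p. Comp Succ [p]) ^^ k) Zero"

lemma const_prog: "oracle_free (const_prog k)" "eval g (const_prog k) xs k"
  unfolding const_prog_def by (induction k) (auto intro: eval_rules)

definition add_prog :: prog where
  "add_prog = Prec (Proj 0) (Comp Succ [Proj 1])"

lemma eval_add_prog: "eval g add_prog [m, n] (m + n)"
  unfolding add_prog_def
proof (induction m)
  case (Suc m)
  show ?case
    unfolding add_Suc by (rule eval_Prec_Suc[OF Suc]) (rule eval_rules)+
qed (auto intro!: eval_Prec_0 eval_rules)

definition pred_prog :: prog where
  "pred_prog = Prec Zero (Proj 0)"

lemma eval_pred_prog: "eval g pred_prog [n] (n - 1)"
  unfolding pred_prog_def
proof (induction n)
  case (Suc n)
  show ?case
    unfolding diff_Suc_1 by (rule eval_Prec_Suc[OF Suc]) (rule eval_rules)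
qed (auto intro!: eval_Prec_0 eval_rules)

text \<open>\<open>Prec\<close> recurses on its first argument, whereas subtraction iterates the
  predecessor along the second one; hence the swapped projections.\<close>

definition diff_prog :: prog where
  "diff_prog = Comp (Prec (Proj 0) (Comp pred_prog [Proj 1])) [Proj 1, Proj 0]"

lemma eval_diff_prog: "eval g diff_prog [m, n] (m - n)"
proof -
  have "eval g (Prec (Proj 0) (Comp pred_prog [Proj 1])) [n, m] (m - n)"
  proof (induction n)
    case (Suc n)
    show ?case
      using eval_pred_prog[of g "m - n"]
      by (intro eval_Prec_Suc[OF Suc] eval_Comp1[OF eval_Proj_simps(2)]) simp
  qed (auto intro!: eval_Prec_0 eval_rules)
  then show ?thesis
    unfolding diff_prog_def by (rule eval_Comp2[OF eval_Proj_simps(2,1)])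
qed

definition triangle_prog :: prog where
  "triangle_prog = Prec Zero (Comp add_prog [Proj 1, Comp Succ [Proj 0]])"

lemma eval_triangle_prog: "eval g triangle_prog [n] (triangle n)"
  unfolding triangle_prog_def
proof (induction n)
  case (Suc n)
  show ?case
    unfolding triangle_Suc by (rule eval_Prec_Suc[OF Suc]) (rule eval_rules eval_add_prog)+
qed (auto intro!: eval_Prec_0 eval_rules)

definition pair_prog :: prog where
  "pair_prog = Comp add_prog [Comp triangle_prog [add_prog], Proj 0]"

lemma eval_pair_prog: "eval g pair_prog [m, n] (prod_encode (m, n))"
  unfolding pair_prog_def prod_encode_def split
  by (rule eval_rules eval_add_prog eval_triangle_prog)+

text \<open>The sum of the two components of the pair coded by \<open>x\<close>.\<close>

fun diagonal :: "nat \<Rightarrow> nat" where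
  "diagonal 0 = 0"
| "diagonal (Suc x) = diagonal x + (1 - (triangle (Suc (diagonal x)) - Suc x))"

text \<open>The truncated difference in the recursion is 1 exactly when \<open>Suc x\<close> has
  reached the next triangular number, so the diagonal advances just then.\<close>

lemma diagonal_bounds: "triangle (diagonal x) \<le> x \<and> x \<le> triangle (diagonal x) + diagonal x"
proof (induction x)
  case (Suc x)
  show ?case
  proof (cases "triangle (Suc (diagonal x)) \<le> Suc x")
    case True
    then have "diagonal (Suc x) = Suc (diagonal x)" by simp
    with Suc True show ?thesis by simp
  next
    case False
    then have "diagonal (Suc x) = diagonal x" by simp
    with Suc False show ?thesis by simp
  qed
qed simp

lemma prod_decode_diagonal:
  "prod_decode x = (x - triangle (diagonal x), diagonal x - (x - triangle (diagonal x)))"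
proof -
  have "x = prod_encode (x - triangle (diagonal x), diagonal x - (x - triangle (diagonal x)))"
    using diagonal_bounds[of x] by (simp add: prod_encode_def)
  then show ?thesis by (metis prod_encode_inverse)
qed

definition diagonal_prog :: prog where
  "diagonal_prog = Prec Zero (Comp add_prog [Proj 1, Comp diff_prog
     [const_prog 1, Comp diff_prog [Comp triangle_prog [Comp Succ [Proj 1]], Comp Succ [Proj 0]]]])"

lemma eval_diagonal_prog: "eval g diagonal_prog [n] (diagonal n)"
  unfolding diagonal_prog_def
proof (induction n)
  case (Suc n)
  show ?case
    unfolding diagonal.simps
    by (rule eval_Prec_Suc[OF Suc])
      (rule eval_rules eval_add_prog eval_diff_prog eval_triangle_prog const_prog)+
qed (auto intro!: eval_Prec_0 eval_rules)

definition fst_prog :: prog where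
  "fst_prog = Comp diff_prog [Proj 0, Comp triangle_prog [diagonal_prog]]"

definition snd_prog :: prog where
  "snd_prog = Comp diff_prog [diagonal_prog, fst_prog]"

lemma eval_fst_prog: "eval g fst_prog [n] (fst (prod_decode n))"
  unfolding fst_prog_def prod_decode_diagonal fst_conv
  by (rule eval_rules eval_diff_prog eval_triangle_prog eval_diagonal_prog)+

lemma eval_snd_prog: "eval g snd_prog [n] (snd (prod_decode n))"
  unfolding snd_prog_def prod_decode_diagonal[of n] snd_conv
  by (rule eval_Comp2[OF eval_diagonal_prog eval_fst_prog[unfolded prod_decode_diagonal fst_conv] eval_diff_prog])

lemma oracle_free_progs:
  "oracle_free add_prog" "oracle_free pred_prog" "oracle_free diff_prog" "oracle_free triangle_prog"
  "oracle_free pair_prog" "oracle_free diagonal_prog" "oracle_free fst_prog" "oracle_free snd_prog"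
  by (simp_all add: add_prog_def pred_prog_def diff_prog_def triangle_prog_def pair_prog_def
      diagonal_prog_def fst_prog_def snd_prog_def const_prog)


section \<open>Recursive functions on coded types\<close>

text \<open>The coding is a bijection with the numbers, not merely an injection. Every number is a
  code, so \<open>encode\<close> and \<open>decode\<close> act as the identity on codes and need no
  program of their own.\<close>

class coded =
  fixes encode :: "'a \<Rightarrow> nat" and decode :: "nat \<Rightarrow> 'a"
  assumes decode_encode [simp]: "decode (encode x) = x"
    and encode_decode [simp]: "encode (decode n) = n"
begin

lemma encode_eq_iff [simp]: "encode x = encode y \<longleftrightarrow> x = y"
  by (metis decode_encode)

end

instantiation nat :: coded
begin
definition encode_nat_def [simp]: "encode (n :: nat) = n"
definition decode_nat_def [simp]: "decode n = (n :: nat)"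
instance by standard simp_all
end

instantiation prod :: (coded, coded) coded
begin
definition "encode x = prod_encode (encode (fst x), encode (snd x))"
definition "decode n = (decode (fst (prod_decode n)), decode (snd (prod_decode n)))"
instance by standard (simp_all add: encode_prod_def decode_prod_def)
end

instantiation list :: (coded) coded
begin
definition "encode xs = list_encode (map encode xs)"
definition "decode n = map decode (list_decode n)"
instance by standard (simp_all add: encode_list_def decode_list_def o_def)
end

lemma encode_Nil: "encode [] = 0"
  and encode_Cons: "encode (x # xs) = Suc (prod_encode (encode x, encode xs))"
  by (simp_all add: encode_list_def)

text \<open>One program has to work with every oracle, so that it can be spliced into oracle
  programs; being oracle free links it to \<open>computable\<close>.\<close>

definition recursive :: "('a::coded \<Rightarrow> 'b::coded) \<Rightarrow> bool" where
  "recursive f \<longleftrightarrow> (\<exists>p. oracle_free p \<and> (\<forall>g x. eval g p [encode x] (encode (f x))))"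

text \<open>The finite type \<open>bool\<close> admits no bijective coding, so truth values are
  represented by the numbers 0 and 1.\<close>

definition decidable :: "('a::coded \<Rightarrow> bool) \<Rightarrow> bool" where
  "decidable R \<longleftrightarrow> recursive (\<lambda>x. of_bool (R x) :: nat)"

lemma recursiveI:
  assumes "oracle_free p" "\<And>g x. eval g p [encode x] (encode (f x))"
  shows "recursive f"
  using assms unfolding recursive_def by blast

lemma recursive_comp:
  assumes "recursive f" "recursive h"
  shows "recursive (\<lambda>x. f (h x))"
proof -
  obtain p q where "oracle_free p" "\<And>g x. eval g p [encode x] (encode (f x))"
    "oracle_free q" "\<And>g x. eval g q [encode x] (encode (h x))"
    using assms unfolding recursive_def by metis
  then show ?thesis
    by (intro recursiveI[of "Comp p [q]"]) (auto intro!: eval_Comp1[of _ q _ "encode (h _)" p])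
qed

lemma decidable_comp: "decidable R \<Longrightarrow> recursive h \<Longrightarrow> decidable (\<lambda>x. R (h x))"
  unfolding decidable_def by (rule recursive_comp)

section \<open>Closure properties of recursive functions, stated with a parameter \<open>x\<close>
  so that they work as syntax-directed rules\<close>

named_theorems recursive_intros

lemma recursive_id [recursive_intros]: "recursive (\<lambda>x. x)"
  by (rule recursiveI[of "Proj 0"]) (auto intro: eval_Proj_nth)

lemma recursive_const [recursive_intros]: "recursive (\<lambda>x. k)"
  by (rule recursiveI[OF const_prog])

lemma recursive_fst [recursive_intros]: "recursive F \<Longrightarrow> recursive (\<lambda>x. fst (F x))"
proof (rule recursive_comp[where f = fst], rule recursiveI[of fst_prog])
  fix g and x :: "'b \<times> 'c"
  show "eval g fst_prog [encode x] (encode (fst x))"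
    using eval_fst_prog[of g "encode x"] by (simp add: encode_prod_def)
qed (simp_all add: oracle_free_progs)

lemma recursive_snd [recursive_intros]: "recursive F \<Longrightarrow> recursive (\<lambda>x. snd (F x))"
proof (rule recursive_comp[where f = snd], rule recursiveI[of snd_prog])
  fix g and x :: "'b \<times> 'c"
  show "eval g snd_prog [encode x] (encode (snd x))"
    using eval_snd_prog[of g "encode x"] by (simp add: encode_prod_def)
qed (simp_all add: oracle_free_progs)

lemma recursive_binary:
  assumes "recursive F" "recursive G" "oracle_free p"
    and "\<And>g x y. eval g p [encode x, encode y] (encode (f x y))"
  shows "recursive (\<lambda>x. f (F x) (G x))"
proof -
  obtain q r where "oracle_free q" "\<And>g x. eval g q [encode x] (encode (F x))"
    "oracle_free r" "\<And>g x. eval g r [encode x] (encode (G x))"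
    using assms(1,2) unfolding recursive_def by metis
  with assms(3,4) show ?thesis
    by (intro recursiveI[of "Comp p [q, r]"])
      (auto intro!: eval_Comp2[of _ q _ "encode (F _)" r "encode (G _)" p])
qed

lemma recursive_Pair [recursive_intros]:
  "recursive F \<Longrightarrow> recursive G \<Longrightarrow> recursive (\<lambda>x. (F x, G x))"
  by (rule recursive_binary[of _ _ pair_prog])
    (auto simp: oracle_free_progs encode_prod_def eval_pair_prog)

lemma recursive_add [recursive_intros]:
  "recursive F \<Longrightarrow> recursive G \<Longrightarrow> recursive (\<lambda>x. F x + G x :: nat)"
  by (rule recursive_binary[of _ _ add_prog]) (auto simp: oracle_free_progs eval_add_prog)

lemma recursive_diff [recursive_intros]:
  "recursive F \<Longrightarrow> recursive G \<Longrightarrow> recursive (\<lambda>x. F x - G x :: nat)"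
  by (rule recursive_binary[of _ _ diff_prog]) (auto simp: oracle_free_progs eval_diff_prog)

lemma recursive_Suc [recursive_intros]: "recursive F \<Longrightarrow> recursive (\<lambda>x. Suc (F x))"
  by (rule recursive_comp[of Suc], rule recursiveI[of Succ]) (auto intro: eval_Succ)

lemma recursive_encode [recursive_intros]: "recursive F \<Longrightarrow> recursive (\<lambda>x. encode (F x))"
  unfolding recursive_def by simp

lemma recursive_decode [recursive_intros]: "recursive F \<Longrightarrow> recursive (\<lambda>x. decode (F x))"
  unfolding recursive_def by simp

lemma recursive_rec_nat [recursive_intros]:
  fixes F :: "'c::coded \<Rightarrow> nat" and A :: "'c \<Rightarrow> 'a::coded"
  assumes "recursive F" "recursive A" "recursive (\<lambda>z. H (fst z) (fst (snd z)) (snd (snd z)))"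
  shows "recursive (\<lambda>x. rec_nat (A x) (\<lambda>n y. H n y x) (F x))"
proof -
  obtain f a h where p: "oracle_free f" "oracle_free a" "oracle_free h"
    and f: "\<And>g x. eval g f [encode x] (F x)" and a: "\<And>g x. eval g a [encode x] (encode (A x))"
    and h: "\<And>g z. eval g h [encode z] (encode (H (fst z) (fst (snd z)) (snd (snd z))))"
    using assms unfolding recursive_def encode_nat_def by metis
  \<comment> \<open>\<open>Prec\<close> hands over counter, previous value and parameter as three
    arguments, while \<open>h\<close> expects one code of the nested pair.\<close>
  let ?h = "Comp h [Comp pair_prog [Proj 0, Comp pair_prog [Proj 1, Proj 2]]]"
  have "eval g (Prec a ?h) [n, encode x] (encode (rec_nat (A x) (\<lambda>n y. H n y x) n))" for g n x
  proof (induction n)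
    case (Suc n)
    show ?case
      using h[of g "(n, rec_nat (A x) (\<lambda>n y. H n y x) n, x)"]
      unfolding encode_prod_def fst_conv snd_conv old.nat.simps(7) encode_nat_def
      by (intro eval_Prec_Suc[OF Suc, unfolded encode_prod_def])
        (assumption | rule eval_rules eval_pair_prog)+
  qed (auto intro: eval_Prec_0 a)
  then have "eval g (Comp (Prec a ?h) [f, Proj 0]) [encode x]
      (encode (rec_nat (A x) (\<lambda>n y. H n y x) (F x)))" for g x
    by (intro eval_Comp2[OF f, where ?y2.0 = "encode x"] eval_Proj_nth) auto
  with p show ?thesis
    by (intro recursiveI[of "Comp (Prec a ?h) [f, Proj 0]"]) (auto simp: oracle_free_progs)
qed

lemma recursive_funpow [recursive_intros]:
  fixes F :: "'c::coded \<Rightarrow> nat" and A :: "'c \<Rightarrow> 'a::coded"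
    and H :: "'a \<Rightarrow> 'c \<Rightarrow> 'a"
  assumes "recursive F" "recursive A" "recursive (\<lambda>z. H (fst z) (snd z))"
  shows "recursive (\<lambda>x. ((\<lambda>y. H y x) ^^ F x) (A x))"
proof -
  have "((\<lambda>y. H y x) ^^ n) a = rec_nat a (\<lambda>n y. H y x) n" for x and n :: nat and a :: 'a
    by (induction n) auto
  then show ?thesis
    by (simp only:) (intro recursive_intros assms recursive_comp[OF assms(3), of snd])
qed

lemma recursive_mult [recursive_intros]:
  fixes F G :: "'c::coded \<Rightarrow> nat"
  assumes "recursive F" "recursive G"
  shows "recursive (\<lambda>x. F x * G x)"
proof -
  have "m * n = rec_nat 0 (\<lambda>_ y. y + n) m" for m n :: nat
    by (induction m) auto
  then show ?thesis
    by (simp only:) (intro recursive_intros assms recursive_comp[OF assms(2)])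
qed

lemma recursive_power [recursive_intros]:
  fixes F G :: "'c::coded \<Rightarrow> nat"
  assumes "recursive F" "recursive G"
  shows "recursive (\<lambda>x. F x ^ G x)"
proof -
  have "m ^ n = rec_nat 1 (\<lambda>_ y. y * m) n" for m n :: nat
    by (induction n) auto
  then show ?thesis
    by (simp only:) (intro recursive_intros assms recursive_comp[OF assms(1)])
qed

lemma recursive_if [recursive_intros]:
  fixes F G :: "'c::coded \<Rightarrow> 'a::coded"
  assumes "decidable R" "recursive F" "recursive G"
  shows "recursive (\<lambda>x. if R x then F x else G x)"
proof -
  \<comment> \<open>A recursion of length 0 or 1 makes the choice.\<close>
  have "(if R x then F x else G x) = rec_nat (G x) (\<lambda>_ _. F x) (of_bool (R x))" for x
    by simp
  then show ?thesis
    using assms(1) unfolding decidable_def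
    by (simp only:) (intro recursive_intros assms recursive_comp[OF assms(2)])
qed

lemma recursive_of_bool [recursive_intros]: "decidable R \<Longrightarrow> recursive (\<lambda>x. of_bool (R x) :: nat)"
  by (simp add: decidable_def)

section \<open>Closure properties of decidable predicates, and unbounded search\<close>

lemma decidable_const [recursive_intros]: "decidable (\<lambda>x. b)"
  unfolding decidable_def by (rule recursive_const)

lemma decidable_not [recursive_intros]:
  assumes "decidable R"
  shows "decidable (\<lambda>x. \<not> R x)"
proof -
  have "of_bool (\<not> b) = (1 :: nat) - of_bool b" for b
    by simp
  then show ?thesis
    using assms unfolding decidable_def by (simp only:) (intro recursive_diff recursive_const)
qed

lemma decidable_conj [recursive_intros]:
  "decidable R \<Longrightarrow> decidable S \<Longrightarrow> decidable (\<lambda>x. R x \<and> S x)"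
  unfolding decidable_def of_bool_conj by (intro recursive_mult)

lemma decidable_disj [recursive_intros]:
  assumes "decidable R" "decidable S"
  shows "decidable (\<lambda>x. R x \<or> S x)"
  using decidable_not[OF decidable_conj[OF assms[THEN decidable_not]]] by simp

lemma decidable_imp [recursive_intros]:
  assumes "decidable R" "decidable S"
  shows "decidable (\<lambda>x. R x \<longrightarrow> S x)"
  unfolding imp_conv_disj by (intro decidable_disj decidable_not assms)

lemma decidable_less [recursive_intros]:
  assumes "recursive F" "recursive G"
  shows "decidable (\<lambda>x. F x < (G x :: nat))"
proof -
  have "of_bool (m < n) = (1::nat) - (Suc m - n)" for m n :: nat
    by simp
  then show ?thesis
    unfolding decidable_def using assms by (simp only:) (intro recursive_intros)
qed

lemma decidable_le [recursive_intros]: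
  assumes "recursive F" "recursive G"
  shows "decidable (\<lambda>x. F x \<le> (G x :: nat))"
  using decidable_not[OF decidable_less[OF assms(2,1)]] by (simp add: not_less)

lemma decidable_eq [recursive_intros]:
  assumes "recursive F" "recursive G"
  shows "decidable (\<lambda>x. F x = G x)"
proof -
  have "F x = G x \<longleftrightarrow> encode (F x) \<le> encode (G x) \<and> encode (G x) \<le> encode (F x)" for x
    by (metis order_antisym encode_eq_iff order_refl)
  then show ?thesis
    using assms by (simp only:) (intro recursive_intros)
qed

lemma decidable_case_nat [recursive_intros]:
  assumes "recursive F" "decidable R" "decidable (\<lambda>z. S (fst z) (snd z))"
  shows "decidable (\<lambda>x. case F x of 0 \<Rightarrow> R x | Suc n \<Rightarrow> S n x)"
proof -
  have "(case F x of 0 \<Rightarrow> R x | Suc n \<Rightarrow> S n x) \<longleftrightarrow>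
      F x = 0 \<and> R x \<or> F x \<noteq> 0 \<and> S (F x - 1) x" for x
    by (auto split: nat.split)
  moreover have "decidable (\<lambda>x. S (F x - 1) x)"
    by (rule decidable_comp[OF assms(3), of "\<lambda>x. (F x - 1, x)", unfolded fst_conv snd_conv])
      (intro recursive_intros assms)
  ultimately show ?thesis
    using assms by (simp only:) (intro recursive_intros)
qed

lemma decidable_ex_less [recursive_intros]:
  fixes F :: "'c::coded \<Rightarrow> nat"
  assumes "recursive F" "decidable (\<lambda>z. R (fst z) (snd z))"
  shows "decidable (\<lambda>x. \<exists>i<F x. R i x)"
proof -
  have *: "of_bool (\<exists>i<n. R i x) = rec_nat (0::nat) (\<lambda>i y. if R i x then 1 else y) n" for n x
  proof (induction n)
    case (Suc n)
    then show ?case by (cases "R n x") (auto simp only: Ex_less_Suc nat.rec if_True if_False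
          of_bool_eq simp_thms)
  qed simp
  have c: "decidable (\<lambda>z. R (fst z) (snd (snd z)))"
    by (rule decidable_comp[OF assms(2), of "\<lambda>z. (fst z, snd (snd z))", unfolded fst_conv snd_conv])
      (intro recursive_intros)
  show ?thesis
    unfolding decidable_def * by (intro recursive_intros assms c)
qed

lemma decidable_all_less [recursive_intros]:
  fixes F :: "'c::coded \<Rightarrow> nat"
  assumes "recursive F" "decidable (\<lambda>z. R (fst z) (snd z))"
  shows "decidable (\<lambda>x. \<forall>i<F x. R i x)"
  using decidable_not[OF decidable_ex_less[OF assms(1) decidable_not[OF assms(2)]]] by simp

lemma recursive_Least:
  fixes R :: "nat \<Rightarrow> 'c::coded \<Rightarrow> bool"
  assumes "decidable (\<lambda>z. R (fst z) (snd z))" "\<And>x. \<exists>n. R n x"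
  shows "recursive (\<lambda>x. LEAST n. R n x)"
proof -
  \<comment> \<open>\<open>Mu\<close> looks for a zero, so the program tests the negation of
    \<open>R\<close>.\<close>
  have "recursive (\<lambda>z. of_bool (\<not> R (fst z) (snd z)) :: nat)"
    using assms(1) by (intro recursive_intros)
  then obtain r where r: "oracle_free r" "\<And>g z. eval g r [encode z] (of_bool (\<not> R (fst z) (snd z)))"
    unfolding recursive_def by auto
  let ?r = "Comp r [pair_prog]"
  have "eval g ?r [n, encode x] (of_bool (\<not> R n x))" for g n x
    using r(2)[of g "(n, x)"] eval_pair_prog[of g n "encode x"]
    by (intro eval_Comp1) (auto simp: encode_prod_def)
  note e = this
  have "eval g (Mu ?r) [encode x] (LEAST n. R n x)" for g x
  proof (intro eval_Mu allI impI)
    show "eval g ?r [LEAST n. R n x, encode x] 0"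
      using e[of g "LEAST n. R n x" x] LeastI_ex[OF assms(2)] by simp
    fix m assume "m < (LEAST n. R n x)"
    then show "\<exists>y. eval g ?r [m, encode x] (Suc y)"
      using e[of g m x] not_less_Least[of m "\<lambda>n. R n x"] by auto
  qed
  then show ?thesis
    using r by (intro recursiveI[of "Mu ?r"]) (auto simp: oracle_free_progs)
qed

section \<open>Recursive functions on lists\<close>

lemma recursive_Cons [recursive_intros]:
  assumes "recursive F" "recursive G"
  shows "recursive (\<lambda>x. F x # G x)"
proof -
  have "F x # G x = decode (Suc (encode (F x, G x)))" for x
    by (metis encode_Cons encode_prod_def decode_encode fst_conv snd_conv)
  then show ?thesis
    using assms by (simp only:) (intro recursive_intros)
qed

lemma recursive_case_list [recursive_intros]:
  fixes L :: "'c::coded \<Rightarrow> 'a::coded list"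
  assumes "recursive L" "recursive A" "recursive (\<lambda>z. B (fst z) (fst (snd z)) (snd (snd z)))"
  shows "recursive (\<lambda>x. case L x of [] \<Rightarrow> A x | y # ys \<Rightarrow> B y ys x)"
proof -
  \<comment> \<open>The code of a nonempty list is one more than the code of the pair of its head
    and tail.\<close>
  let ?d = "\<lambda>x. decode (encode (L x) - 1) :: 'a \<times> 'a list"
  have d: "?d x = (y, ys)" if "L x = y # ys" for x y ys
    using that by (simp add: encode_Cons decode_prod_def)
  have "(case L x of [] \<Rightarrow> A x | y # ys \<Rightarrow> B y ys x) =
      (if encode (L x) = 0 then A x else B (fst (?d x)) (snd (?d x)) x)" for x
  proof (cases "L x")
    case (Cons y ys)
    with d[OF this] show ?thesis by (simp add: encode_Cons)
  qed (simp add: encode_Nil)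
  moreover have "recursive (\<lambda>x. B (fst (?d x)) (snd (?d x)) x)"
    by (rule recursive_comp[OF assms(3), of "\<lambda>x. (fst (?d x), snd (?d x), x)", unfolded fst_conv snd_conv])
      (intro recursive_intros assms)
  ultimately show ?thesis
    using assms by (simp only:) (intro recursive_intros)
qed

lemma decidable_case_list [recursive_intros]:
  fixes L :: "'c::coded \<Rightarrow> 'a::coded list"
  assumes "recursive L" "decidable A" "decidable (\<lambda>z. B (fst z) (fst (snd z)) (snd (snd z)))"
  shows "decidable (\<lambda>x. case L x of [] \<Rightarrow> A x | y # ys \<Rightarrow> B y ys x)"
  using recursive_case_list[OF assms(1) assms(2,3)[unfolded decidable_def]]
  unfolding decidable_def by (simp add: list.case_distrib[of of_bool] cong: list.case_cong)

lemma length_le_encode: "length xs \<le> encode xs"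
  by (induction xs) (auto simp: encode_Nil encode_Cons intro: le_trans[OF _ le_prod_encode_2])

text \<open>The fold is an iteration on pairs of accumulator and remaining list. The code of the
  list bounds its length and is available at no cost; surplus iterations idle on the empty
  list.\<close>

lemma recursive_foldl [recursive_intros]:
  fixes L :: "'c::coded \<Rightarrow> 'a::coded list" and A :: "'c \<Rightarrow> 'b::coded"
  assumes "recursive L" "recursive A" "recursive (\<lambda>z. H (fst z) (fst (snd z)) (snd (snd z)))"
  shows "recursive (\<lambda>x. foldl (\<lambda>a y. H a y x) (A x) (L x))"
proof -
  define step where "step = (\<lambda>(z :: 'b \<times> 'a list) x.
    case snd z of [] \<Rightarrow> z | y # ys \<Rightarrow> (H (fst z) y x, ys))"
  have step: "fst (((\<lambda>z. step z x) ^^ n) (a, ys)) = foldl (\<lambda>a y. H a y x) a ys" if "length ys \<le> n" for x n a ys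
    using that
  proof (induction n arbitrary: a ys)
    case (Suc n)
    show ?case
    proof (cases ys)
      case Nil
      have "((\<lambda>z. step z x) ^^ k) (a, []) = (a, [])" for k
        by (induction k) (auto simp: step_def)
      with Nil show ?thesis by (simp del: funpow.simps)
    next
      case (Cons y ys')
      have "step (a, y # ys') x = (H a y x, ys')"
        by (simp add: step_def)
      then have "((\<lambda>z. step z x) ^^ Suc n) (a, ys) = ((\<lambda>z. step z x) ^^ n) (H a y x, ys')"
        by (simp only: funpow_Suc_right o_apply Cons)
      with Suc Cons show ?thesis by simp
    qed
  qed simp
  have "recursive (\<lambda>w. H (fst (fst (snd (snd w)))) (fst w) (snd (snd (snd w))))"
    by (rule recursive_comp[OF assms(3), of "\<lambda>w. (fst (fst (snd (snd w))), fst w, snd (snd (snd w)))",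
          unfolded fst_conv snd_conv])
      (intro recursive_intros)
  then have "recursive (\<lambda>z. step (fst z) (snd z))"
    unfolding step_def by (intro recursive_intros)
  then have "recursive (\<lambda>x. fst (((\<lambda>z. step z x) ^^ encode (L x)) (A x, L x)))"
    by (intro recursive_intros assms)
  then show ?thesis
    by (simp add: step length_le_encode)
qed

lemma recursive_rev [recursive_intros]:
  assumes "recursive L"
  shows "recursive (\<lambda>x. rev (L x))"
proof -
  have "rev xs = foldl (\<lambda>a y. y # a) [] xs" for xs :: "'b list"
    by (induction xs rule: rev_induct) auto
  then show ?thesis using assms by (simp only:) (intro recursive_intros)
qed

lemma recursive_append [recursive_intros]:
  assumes "recursive L" "recursive M"
  shows "recursive (\<lambda>x. L x @ M x)"
proof -
  have "xs @ ys = foldl (\<lambda>a y. y # a) ys (rev xs)" for xs ys :: "'b list"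
    by (induction xs) auto
  then show ?thesis using assms by (simp only:) (intro recursive_intros)
qed

text \<open>Structural recursion is a left fold over the reversed list; the accumulator also carries
  the tail already traversed, which the step function may inspect.\<close>

lemma recursive_rec_list:
  fixes L :: "'c::coded \<Rightarrow> 'a::coded list" and A :: "'c \<Rightarrow> 'b::coded"
  assumes "recursive L" "recursive A"
    "recursive (\<lambda>z. H (fst z) (fst (snd z)) (fst (snd (snd z))) (snd (snd (snd z))))"
  shows "recursive (\<lambda>x. rec_list (A x) (\<lambda>y ys a. H y ys a x) (L x))"
proof -
  have *: "foldl (\<lambda>a y. (H y (snd a) (fst a) x, y # snd a)) (b, []) (rev ys) =
      (rec_list b (\<lambda>y ys a. H y ys a x) ys, ys)" for b ys x
    by (induction ys) auto
  have "recursive (\<lambda>w. H (fst (snd w)) (snd (fst w)) (fst (fst w)) (snd (snd w)))"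
    by (rule recursive_comp[OF assms(3), of "\<lambda>w. (fst (snd w), snd (fst w), fst (fst w), snd (snd w))",
          unfolded fst_conv snd_conv])
      (intro recursive_intros)
  then have "recursive (\<lambda>x. fst (foldl (\<lambda>a y. (H y (snd a) (fst a) x, y # snd a)) (A x, []) (rev (L x))))"
    by (intro recursive_intros assms)
  then show ?thesis by (simp add: *)
qed

lemma recursive_length [recursive_intros]:
  assumes "recursive L"
  shows "recursive (\<lambda>x. length (L x))"
proof -
  have "length xs = foldl (\<lambda>a y. Suc a) 0 xs" for xs :: "'b list"
    by (induction xs rule: rev_induct) auto
  then show ?thesis using assms by (simp only:) (intro recursive_intros)
qed

lemma recursive_map [recursive_intros]:
  fixes L :: "'c::coded \<Rightarrow> 'a::coded list" and H :: "'a \<Rightarrow> 'c \<Rightarrow> 'b::coded"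
  assumes "recursive L" "recursive (\<lambda>z. H (fst z) (snd z))"
  shows "recursive (\<lambda>x. map (\<lambda>y. H y x) (L x))"
proof -
  have *: "map f xs = foldl (\<lambda>a y. a @ [f y]) [] xs" for xs and f :: "'a \<Rightarrow> 'b"
    by (induction xs rule: rev_induct) auto
  have c: "recursive (\<lambda>z. H (fst (snd z)) (snd (snd z)))"
    by (rule recursive_comp[OF assms(2), of snd]) (intro recursive_intros)
  show ?thesis
    unfolding * by (intro recursive_intros assms c)
qed

lemma recursive_filter [recursive_intros]:
  fixes L :: "'c::coded \<Rightarrow> 'a::coded list"
  assumes "recursive L" "decidable (\<lambda>z. R (fst z) (snd z))"
  shows "recursive (\<lambda>x. filter (\<lambda>y. R y x) (L x))"
proof -
  have *: "filter f xs = foldl (\<lambda>a y. if f y then a @ [y] else a) [] xs" for xs :: "'a list" and f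
    by (induction xs rule: rev_induct) auto
  have c: "decidable (\<lambda>z. R (fst (snd z)) (snd (snd z)))"
    by (rule decidable_comp[OF assms(2), of snd]) (intro recursive_intros)
  show ?thesis
    unfolding * by (intro recursive_intros assms c)
qed

lemma decidable_bex [recursive_intros]:
  assumes "recursive L" "decidable (\<lambda>z. R (fst z) (snd z))"
  shows "decidable (\<lambda>x. \<exists>y\<in>set (L x). R y x)"
proof -
  have "(\<exists>y\<in>set (L x). R y x) \<longleftrightarrow> length (filter (\<lambda>y. R y x) (L x)) \<noteq> 0" for x
    by (auto simp: filter_empty_conv)
  then show ?thesis by (simp only:) (intro recursive_intros assms)
qed

lemma decidable_ball [recursive_intros]:
  assumes "recursive L" "decidable (\<lambda>z. R (fst z) (snd z))"
  shows "decidable (\<lambda>x. \<forall>y\<in>set (L x). R y x)"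
  using decidable_not[OF decidable_bex[OF assms(1) decidable_not[OF assms(2)]]] by simp

lemma decidable_member [recursive_intros]:
  assumes "recursive F" "recursive L"
  shows "decidable (\<lambda>x. F x \<in> set (L x))"
proof -
  have "decidable (\<lambda>x. \<exists>y\<in>set (L x). y = F x)"
    by (intro recursive_intros recursive_comp[OF assms(1)] assms)
  then show ?thesis by simp
qed

lemma recursive_tl [recursive_intros]:
  assumes "recursive L"
  shows "recursive (\<lambda>x. tl (L x))"
  unfolding tl_def by (intro recursive_intros assms)

lemma recursive_drop [recursive_intros]:
  assumes "recursive F" "recursive L"
  shows "recursive (\<lambda>x. drop (F x) (L x))"
proof -
  have "drop n xs = (tl ^^ n) xs" for n and xs :: "'b list"
    by (induction n arbitrary: xs) (auto simp: drop_Suc funpow_swap1 drop_tl)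
  then show ?thesis
    by (simp only:) (intro recursive_intros assms)
qed

lemma recursive_take [recursive_intros]:
  assumes "recursive F" "recursive L"
  shows "recursive (\<lambda>x. take (F x) (L x))"
proof -
  have "take n xs = rev (drop (length xs - n) (rev xs))" for n and xs :: "'b list"
    by (cases "n \<le> length xs") (simp_all add: rev_drop)
  then show ?thesis
    by (simp only:) (intro recursive_intros assms)
qed

lemma recursive_upt [recursive_intros]:
  assumes "recursive F" "recursive G"
  shows "recursive (\<lambda>x. [F x..<G x])"
proof -
  have "[0..<n] = rec_nat [] (\<lambda>k l. l @ [k]) n" for n
    by (induction n) auto
  then have "[m..<n] = drop m (rec_nat [] (\<lambda>k l. l @ [k]) n)" for m n
    by (metis add.left_neutral drop_upt)
  then show ?thesis
    by (simp only:) (intro recursive_intros assms)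
qed

lemma recursive_replicate [recursive_intros]:
  assumes "recursive F" "recursive G"
  shows "recursive (\<lambda>x. replicate (F x) (G x))"
proof -
  have "replicate n a = map (\<lambda>_. a) [0..<n]" for n and a :: 'b
    by (simp add: map_replicate_trivial)
  then show ?thesis
    by (simp only:) (intro recursive_intros assms recursive_comp[OF assms(2)])
qed

text \<open>The library's indexing has no specified value beyond the end of a list; a fixed default
  there gives a total function that a program can compute.\<close>

definition nth_default0 :: "nat list \<Rightarrow> nat \<Rightarrow> nat" where
  "nth_default0 xs i = (case drop i xs of [] \<Rightarrow> 0 | y # ys \<Rightarrow> y)"

lemma nth_default0 [simp]: "i < length xs \<Longrightarrow> nth_default0 xs i = xs ! i"
  unfolding nth_default0_def by (simp add: Cons_nth_drop_Suc[symmetric])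

lemma recursive_nth_default0 [recursive_intros]:
  assumes "recursive F" "recursive L"
  shows "recursive (\<lambda>x. nth_default0 (L x) (F x))"
  unfolding nth_default0_def by (intro recursive_intros assms)

section \<open>A universal evaluation predicate\<close>

fun prog_code :: "prog \<Rightarrow> nat" where
  "prog_code Zero = encode (0 :: nat, 0 :: nat)"
| "prog_code Succ = encode (1 :: nat, 0 :: nat)"
| "prog_code (Proj i) = encode (2 :: nat, i)"
| "prog_code Oracle = encode (3 :: nat, 0 :: nat)"
| "prog_code (Comp f hs) = encode (4 :: nat, encode (prog_code f, map prog_code hs))"
| "prog_code (Prec f h) = encode (5 :: nat, encode (prog_code f, prog_code h))"
| "prog_code (Mu f) = encode (6 :: nat, prog_code f)"

text \<open>
  A judgement \<open>(q, xs, y)\<close> says that the program with code \<open>q\<close> returns \<open>y\<close> on \<open>xs\<close>.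
  A derivation is a list of judgements, each justified by the ones after it, where oracle
  queries are answered by a finite string \<open>\<sigma>\<close>.
\<close>

type_synonym judgement = "nat \<times> nat list \<times> nat"

definition "tag q = fst (decode q :: nat \<times> nat)"
definition "arg q = snd (decode q :: nat \<times> nat)"

definition justified :: "nat list \<Rightarrow> nat \<Rightarrow> nat list \<Rightarrow> nat \<Rightarrow> judgement list \<Rightarrow> bool" where
  "justified \<sigma> q xs y l \<longleftrightarrow>
     tag q = 0 \<and> y = 0 \<or>
     tag q = 1 \<and> y \<noteq> 0 \<and> xs = [y - 1] \<or>
     tag q = 2 \<and> arg q < length xs \<and> y = nth_default0 xs (arg q) \<or>
     tag q = 3 \<and> (\<exists>i<length \<sigma>. xs = [i] \<and> y = nth_default0 \<sigma> i) \<or>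
     tag q = 4 \<and> (\<exists>k\<in>set l. fst k = fst (decode (arg q) :: nat \<times> nat list) \<and> snd (snd k) = y \<and>
       length (fst (snd k)) = length (snd (decode (arg q) :: nat \<times> nat list)) \<and>
       (\<forall>i<length (fst (snd k)).
         (nth_default0 (snd (decode (arg q) :: nat \<times> nat list)) i, xs, nth_default0 (fst (snd k)) i) \<in> set l)) \<or>
     tag q = 5 \<and> (case xs of [] \<Rightarrow> False | n # xs' \<Rightarrow> (case n of
         0 \<Rightarrow> (fst (decode (arg q) :: nat \<times> nat), xs', y) \<in> set l
       | Suc m \<Rightarrow> \<exists>k\<in>set l. fst k = q \<and> fst (snd k) = m # xs' \<and>
           (snd (decode (arg q) :: nat \<times> nat), m # snd (snd k) # xs', y) \<in> set l)) \<or>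
     tag q = 6 \<and> (arg q, y # xs, 0) \<in> set l \<and>
       (\<forall>m<y. \<exists>k\<in>set l. fst k = arg q \<and> fst (snd k) = m # xs \<and> snd (snd k) \<noteq> 0)"

primrec derivation :: "nat list \<Rightarrow> judgement list \<Rightarrow> bool" where
  "derivation \<sigma> [] \<longleftrightarrow> True"
| "derivation \<sigma> (j # l) \<longleftrightarrow> justified \<sigma> (fst j) (fst (snd j)) (snd (snd j)) l \<and> derivation \<sigma> l"

lemma decidable_justified:
  "decidable (\<lambda>z. justified (fst z) (fst (snd z)) (fst (snd (snd z))) (fst (snd (snd (snd z))))
     (snd (snd (snd (snd z)))))"
  unfolding justified_def tag_def arg_def by (intro recursive_intros)

lemma decidable_derivation: "decidable (\<lambda>z. derivation (fst z) (snd z))"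
proof -
  have *: "of_bool (derivation \<sigma> l) = rec_list (1 :: nat) (\<lambda>j l a.
      if justified \<sigma> (fst j) (fst (snd j)) (snd (snd j)) l \<and> a = 1 then 1 else 0) l" for \<sigma> l
    by (induction l) auto
  have c: "decidable (\<lambda>w :: judgement \<times> judgement list \<times> nat \<times> nat list \<times> judgement list. justified (fst (snd (snd (snd w)))) (fst (fst w)) (fst (snd (fst w)))
      (snd (snd (fst w))) (fst (snd w)))"
    by (rule decidable_comp[OF decidable_justified, of "\<lambda>w :: judgement \<times> judgement list \<times> nat \<times> nat list \<times> judgement list.
          (fst (snd (snd (snd w))), fst (fst w), fst (snd (fst w)), snd (snd (fst w)), fst (snd w))",
          unfolded fst_conv snd_conv])
      (intro recursive_intros)
  show ?thesis
    unfolding decidable_def * by (intro recursive_rec_list recursive_intros c)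
qed

lemma tag_arg_prog_code [simp]:
  "tag (encode (a, b)) = a" "arg (encode (a, b)) = b"
  by (simp_all add: tag_def arg_def)

section \<open>Soundness and completeness of finite derivations\<close>

lemma derivation_sound:
  assumes "derivation \<sigma> l" "\<And>k. k < length \<sigma> \<Longrightarrow> g k = \<sigma> ! k" "(prog_code p, xs, y) \<in> set l"
  shows "eval g p xs y"
  using assms
proof (induction l arbitrary: p xs y)
  case (Cons j l)
  \<comment> \<open>The induction follows the list. All premises of a judgement stand after it, so
    the calls that \<open>Prec\<close> and \<open>Mu\<close> make to the same or to another program
    are covered alike.\<close>
  have IH: "(prog_code p', xs', y') \<in> set l \<Longrightarrow> eval g p' xs' y'" for p' xs' y'
    using Cons by auto
  show ?case
  proof (cases "(prog_code p, xs, y) \<in> set l")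
    case False
    with Cons.prems have j: "justified \<sigma> (prog_code p) xs y l"
      by auto
    show ?thesis
    proof (cases p)
      case Zero
      with j show ?thesis by (simp add: justified_def eval_Zero)
    next
      case Succ
      with j show ?thesis by (cases y) (auto simp: justified_def eval_Succ)
    next
      case (Proj i)
      with j show ?thesis by (auto simp: justified_def eval_Proj)
    next
      case Oracle
      with j Cons.prems(2) show ?thesis by (auto simp: justified_def intro!: eval_Oracle) (metis eval_Oracle)
    next
      case (Comp f hs)
      with j obtain ys where ys: "(prog_code f, ys, y) \<in> set l" "length ys = length hs"
        "\<And>i. i < length ys \<Longrightarrow> (nth_default0 (map prog_code hs) i, xs, nth_default0 ys i) \<in> set l"
        by (auto simp: justified_def)
      then have "eval g (hs ! i) xs (ys ! i)" if "i < length hs" for i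
        using that by (intro IH) (metis length_map nth_default0 nth_map)
      with ys show ?thesis
        unfolding Comp by (intro eval_Comp[of ys]) (auto intro: IH)
    next
      case (Prec f h)
      with j obtain n xs' where xs: "xs = n # xs'"
        by (auto simp: justified_def split: list.splits)
      show ?thesis
      proof (cases n)
        case 0
        with j xs Prec have "(prog_code f, xs', y) \<in> set l"
          by (simp add: justified_def)
        with 0 xs Prec show ?thesis
          by (simp add: eval_Prec_0 IH)
      next
        case (Suc m)
        with j xs Prec obtain z where "(prog_code p, m # xs', z) \<in> set l"
          "(prog_code h, m # z # xs', y) \<in> set l"
          by (auto simp: justified_def)
        then have "eval g p (m # xs') z" "eval g h (m # z # xs') y"
          by (auto intro: IH)
        with Suc xs Prec show ?thesis
          by (auto intro: eval_Prec_Suc)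
      qed
    next
      case (Mu f)
      with j have y: "(prog_code f, y # xs, 0) \<in> set l"
        and m: "\<forall>m<y. \<exists>k\<in>set l. fst k = prog_code f \<and> fst (snd k) = m # xs \<and> snd (snd k) \<noteq> 0"
        by (simp_all add: justified_def)
      have "\<exists>z. eval g f (m # xs) (Suc z)" if less: "m < y" for m
      proof -
        obtain k where k: "k \<in> set l" "fst k = prog_code f" "fst (snd k) = m # xs" "snd (snd k) \<noteq> 0"
          using m less by blast
        then have "k = (prog_code f, m # xs, Suc (snd (snd k) - 1))"
          by (simp add: prod_eq_iff)
        with k(1) show ?thesis by (metis IH)
      qed
      with y show ?thesis
        unfolding Mu by (intro eval_Mu IH) auto
    qed
  qed (rule IH)
qed simp

lemma justified_mono:
  assumes "justified \<sigma> q xs y l" "Sublist.prefix \<sigma> \<sigma>'" "set l \<subseteq> set l'"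
  shows "justified \<sigma>' q xs y l'"
proof -
  have q: "\<exists>i<length \<sigma>'. xs = [i] \<and> y = nth_default0 \<sigma>' i"
    if "\<exists>i<length \<sigma>. xs = [i] \<and> y = nth_default0 \<sigma> i"
    using that assms(2) by (auto simp: prefix_def nth_append)
  show ?thesis
    using assms(1,3) q unfolding justified_def
    apply (elim disjE conjE)
          apply (simp_all split: list.split nat.split list.split_asm nat.split_asm)
          apply (blast | fastforce)+
    done
qed

lemma derivation_mono: "derivation \<sigma> l \<Longrightarrow> Sublist.prefix \<sigma> \<sigma>' \<Longrightarrow> derivation \<sigma>' l"
  by (induction l) (auto intro: justified_mono)

lemma derivation_append: "derivation \<sigma> l \<Longrightarrow> derivation \<sigma> l' \<Longrightarrow> derivation \<sigma> (l @ l')"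
  by (induction l) (auto intro: justified_mono)

definition derivable :: "nat list \<Rightarrow> judgement \<Rightarrow> bool" where
  "derivable \<sigma> j \<longleftrightarrow> (\<exists>l. derivation \<sigma> l \<and> j \<in> set l)"

lemma derivable_mono: "derivable \<sigma> j \<Longrightarrow> Sublist.prefix \<sigma> \<sigma>' \<Longrightarrow> derivable \<sigma>' j"
  unfolding derivable_def using derivation_mono by blast

lemma derivable_finite:
  assumes "finite J" "\<And>j. j \<in> J \<Longrightarrow> derivable \<sigma> j"
  shows "\<exists>l. derivation \<sigma> l \<and> J \<subseteq> set l"
  using assms
proof (induction J)
  case (insert j J)
  then obtain l l' where "derivation \<sigma> l" "J \<subseteq> set l" "derivation \<sigma> l'" "j \<in> set l'"
    unfolding derivable_def by blast
  then show ?case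
    by (intro exI[of _ "l @ l'"]) (auto intro: derivation_append)
qed (auto intro: exI[of _ "[]"])

lemma derivableI:
  assumes "finite J" "\<And>j. j \<in> J \<Longrightarrow> derivable \<sigma> j" "\<And>l. J \<subseteq> set l \<Longrightarrow> justified \<sigma> q xs y l"
  shows "derivable \<sigma> (q, xs, y)"
proof -
  obtain l where "derivation \<sigma> l" "J \<subseteq> set l"
    using derivable_finite assms(1,2) by blast
  with assms(3) show ?thesis
    unfolding derivable_def by (intro exI[of _ "(q, xs, y) # l"]) simp
qed

lemma prefix_map_upt: "u \<le> u' \<Longrightarrow> Sublist.prefix (map g [0..<u]) (map g [0..<u'])"
  by (metis le_add_diff_inverse map_append prefixI upt_add_eq_append zero_le)

text \<open>Each evaluation rule has finitely many premises, so their derivations can be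
  concatenated over one common oracle prefix, as long as the longest prefix among them.\<close>

lemma derivable_complete:
  assumes "eval g p xs y"
  shows "\<exists>u. derivable (map g [0..<u]) (prog_code p, xs, y)"
  using assms
proof (induction rule: eval.induct)
  case (eval_Zero xs)
  show ?case by (rule exI, rule derivableI[of "{}"]) (auto simp: justified_def)
next
  case (eval_Succ x)
  show ?case by (rule exI, rule derivableI[of "{}"]) (auto simp: justified_def)
next
  case (eval_Proj i xs)
  then show ?case by (intro exI, intro derivableI[of "{}"]) (auto simp: justified_def)
next
  case (eval_Oracle x)
  show ?case
    by (rule exI[of _ "Suc x"], rule derivableI[of "{}"]) (auto simp: justified_def nth_append simp del: upt_Suc)
next
  case (eval_Comp ys hs xs f z)
  have "\<exists>u. \<forall>i<length hs. derivable (map g [0..<u]) (prog_code (hs ! i), xs, ys ! i)"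
    using eval_Comp.IH(1) by (intro finite_use) (auto intro: derivable_mono prefix_map_upt)
  then obtain u u' where u: "\<And>i. i < length hs \<Longrightarrow> derivable (map g [0..<u]) (prog_code (hs ! i), xs, ys ! i)"
    and u': "derivable (map g [0..<u']) (prog_code f, ys, z)"
    using eval_Comp.IH(2) by blast
  let ?u = "max u u'" and ?J = "insert (prog_code f, ys, z) ((\<lambda>i. (prog_code (hs ! i), xs, ys ! i)) ` {..<length hs})"
  have "derivable (map g [0..<?u]) (prog_code (Comp f hs), xs, z)"
  proof (rule derivableI[of ?J])
    fix j assume "j \<in> ?J"
    then show "derivable (map g [0..<?u]) j"
      using derivable_mono[OF u' prefix_map_upt[of u' ?u]] derivable_mono[OF u prefix_map_upt[of u ?u]] by auto
  next
    fix l assume "?J \<subseteq> set l"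
    then show "justified (map g [0..<?u]) (prog_code (Comp f hs)) xs z l"
      using eval_Comp.hyps(1) by (auto simp: justified_def intro!: bexI[of _ "(prog_code f, ys, z)"])
  qed auto
  then show ?case by blast
next
  case (eval_Prec_0 f xs z h)
  then obtain u where "derivable (map g [0..<u]) (prog_code f, xs, z)"
    by blast
  then show ?case
    by (intro exI[of _ u], intro derivableI[of "{(prog_code f, xs, z)}"]) (auto simp: justified_def)
next
  case (eval_Prec_Suc f h n xs y z)
  then obtain u u' where u: "derivable (map g [0..<u]) (prog_code (Prec f h), n # xs, y)"
    and u': "derivable (map g [0..<u']) (prog_code h, n # y # xs, z)"
    by blast
  let ?u = "max u u'" and ?J = "{(prog_code (Prec f h), n # xs, y), (prog_code h, n # y # xs, z)}"
  have "derivable (map g [0..<?u]) (prog_code (Prec f h), Suc n # xs, z)"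
  proof (rule derivableI[of ?J])
    fix j assume "j \<in> ?J"
    then show "derivable (map g [0..<?u]) j"
      using derivable_mono[OF u' prefix_map_upt[of u' ?u]] derivable_mono[OF u prefix_map_upt[of u ?u]] by auto
  next
    fix l assume J: "?J \<subseteq> set l"
    then have "\<exists>k\<in>set l. fst k = prog_code (Prec f h) \<and> fst (snd k) = n # xs \<and>
        (prog_code h, n # snd (snd k) # xs, z) \<in> set l"
      by (intro bexI[of _ "(prog_code (Prec f h), n # xs, y)"]) auto
    then show "justified (map g [0..<?u]) (prog_code (Prec f h)) (Suc n # xs) z l"
      by (simp add: justified_def)
  qed auto
  then show ?case by blast
next
  case (eval_Mu f n xs)
  have "\<exists>u. \<forall>m<n. \<exists>y. derivable (map g [0..<u]) (prog_code f, m # xs, Suc y)"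
    using eval_Mu.IH(2) by (intro finite_use) (blast intro: derivable_mono prefix_map_upt)+
  then obtain u Y where u: "\<And>m. m < n \<Longrightarrow> derivable (map g [0..<u]) (prog_code f, m # xs, Suc (Y m))"
    by metis
  obtain u' where u': "derivable (map g [0..<u']) (prog_code f, n # xs, 0)"
    using eval_Mu.IH(1) by blast
  let ?u = "max u u'" and ?J = "insert (prog_code f, n # xs, 0) ((\<lambda>m. (prog_code f, m # xs, Suc (Y m))) ` {..<n})"
  have "derivable (map g [0..<?u]) (prog_code (Mu f), xs, n)"
  proof (rule derivableI[of ?J])
    fix j assume "j \<in> ?J"
    then show "derivable (map g [0..<?u]) j"
      using derivable_mono[OF u' prefix_map_upt[of u' ?u]] derivable_mono[OF u prefix_map_upt[of u ?u]] by auto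
  next
    fix l assume J: "?J \<subseteq> set l"
    then have "\<exists>k\<in>set l. fst k = prog_code f \<and> fst (snd k) = m # xs \<and> snd (snd k) \<noteq> 0" if "m < n" for m
      using that by (intro bexI[of _ "(prog_code f, m # xs, Suc (Y m))"]) auto
    with J show "justified (map g [0..<?u]) (prog_code (Mu f)) xs n l"
      by (simp add: justified_def)
  qed auto
  then show ?case by blast
qed

text \<open>The step bound \<open>s\<close> bounds the code of a derivation, which makes halting
  within \<open>s\<close> a decidable bounded search. The oracle is only the string
  \<open>\<sigma>\<close>; queries beyond it have no derivation.\<close>

definition run :: "nat list \<Rightarrow> nat \<Rightarrow> nat \<Rightarrow> nat \<Rightarrow> nat \<Rightarrow> bool" where
  "run \<sigma> s q n v \<longleftrightarrow> (\<exists>d<s. derivation \<sigma> (decode d) \<and> (q, [n], v) \<in> set (decode d))"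

lemma decidable_run [recursive_intros]:
  assumes "recursive A" "recursive B" "recursive C" "recursive D" "recursive E"
  shows "decidable (\<lambda>x. run (A x) (B x) (C x) (D x) (E x))"
proof -
  have c: "decidable (\<lambda>w :: nat \<times> nat list \<times> nat \<times> nat \<times> nat \<times> nat. derivation (fst (snd w)) (decode (fst w)))"
    by (rule decidable_comp[OF decidable_derivation,
          of "\<lambda>w :: nat \<times> nat list \<times> nat \<times> nat \<times> nat \<times> nat. (fst (snd w), decode (fst w))", unfolded fst_conv snd_conv])
      (intro recursive_intros)
  have "decidable (\<lambda>z. run (fst z) (fst (snd z)) (fst (snd (snd z))) (fst (snd (snd (snd z))))
     (snd (snd (snd (snd z)))))"
    unfolding run_def by (intro recursive_intros c)
  from decidable_comp[OF this, of "\<lambda>x. (A x, B x, C x, D x, E x)", unfolded fst_conv snd_conv]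
  show ?thesis by (simp add: recursive_intros assms)
qed

lemma run_sound:
  assumes "run \<sigma> s (prog_code p) n v" "\<And>k. k < length \<sigma> \<Longrightarrow> g k = \<sigma> ! k"
  shows "eval g p [n] v"
  using assms derivation_sound unfolding run_def by blast

lemma run_mono: "run \<sigma> s q n v \<Longrightarrow> Sublist.prefix \<sigma> \<sigma>' \<Longrightarrow> s \<le> s' \<Longrightarrow> run \<sigma>' s' q n v"
  unfolding run_def using derivation_mono less_le_trans by blast

lemma run_complete:
  assumes "eval g p [n] v"
  shows "\<exists>u. \<forall>s\<ge>u. \<forall>t\<ge>u. run (map g [0..<t]) s (prog_code p) n v"
proof -
  obtain u l where "derivation (map g [0..<u]) l" "(prog_code p, [n], v) \<in> set l"
    using derivable_complete[OF assms] unfolding derivable_def by blast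
  then have "run (map g [0..<u]) (Suc (encode l)) (prog_code p) n v"
    unfolding run_def by (intro exI[of _ "encode l"]) simp
  then show ?thesis
    by (intro exI[of _ "max u (Suc (encode l))"]) (auto intro: run_mono prefix_map_upt)
qed

section \<open>Searching along the oracle\<close>

text \<open>The program reads longer and longer oracle prefixes until \<open>R\<close> accepts, then
  applies \<open>U\<close> to the prefix reached. Reductions can thereby be specified on finite
  strings instead of program syntax.\<close>

lemma search_program:
  fixes R :: "nat list \<Rightarrow> nat \<Rightarrow> bool" and U :: "nat list \<Rightarrow> nat \<Rightarrow> nat"
  assumes "decidable (\<lambda>z. R (fst z) (snd z))" "recursive (\<lambda>z. U (fst z) (snd z))"
  obtains p where "\<And>g n w. R (map g [0..<w]) n \<Longrightarrow> (\<And>w'. w' < w \<Longrightarrow> \<not> R (map g [0..<w']) n) \<Longrightarrow>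
    eval g p [n] (U (map g [0..<w]) n)"
proof -
  \<comment> \<open>Primitive recursion accumulates the prefix by consing, so \<open>pre\<close>
    delivers it reversed; both tests and outputs undo this.\<close>
  have "recursive (\<lambda>z. of_bool (\<not> R (rev (fst z)) (snd z)) :: nat)"
    by (rule recursive_comp[of "\<lambda>z. of_bool (\<not> R (fst z) (snd z)) :: nat" "\<lambda>z. (rev (fst z), snd z)",
          unfolded fst_conv snd_conv])
      (intro recursive_intros assms)+
  then obtain r where r: "\<And>g z. eval g r [encode z] (of_bool (\<not> R (rev (fst z)) (snd z)))"
    unfolding recursive_def encode_nat_def by blast
  have "recursive (\<lambda>z. U (rev (fst z)) (snd z))"
    by (rule recursive_comp[OF assms(2), of "\<lambda>z. (rev (fst z), snd z)", unfolded fst_conv snd_conv])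
      (intro recursive_intros)
  then obtain u where u: "\<And>g z. eval g u [encode z] (U (rev (fst z)) (snd z))"
    unfolding recursive_def encode_nat_def by blast
  define pre where "pre = Prec Zero (Comp Succ [Comp pair_prog [Comp Oracle [Proj 0], Proj 1]])"
  have pre: "eval g pre [w] (encode (rev (map g [0..<w])))" for g w
    unfolding pre_def
  proof (induction w)
    case 0
    show ?case by (auto simp: encode_Nil intro: eval_Prec_0 eval_Zero)
  next
    case (Suc w)
    have "encode (rev (map g [0..<Suc w])) = Suc (prod_encode (g w, encode (rev (map g [0..<w]))))"
      by (simp add: encode_Cons)
    then show ?case
      by (simp only:) (rule eval_Prec_Suc[OF Suc], (rule eval_rules eval_pair_prog eval_Oracle)+)
  qed
  let ?b = "Comp r [Comp pair_prog [Comp pre [Proj 0], Proj 1]]"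
  have b: "eval g ?b [w, n] (of_bool (\<not> R (map g [0..<w]) n))" for g w n
    using r[of g "(rev (map g [0..<w]), n)"] unfolding encode_prod_def
    by (intro eval_Comp1[OF eval_Comp2[OF eval_Comp1[OF eval_Proj_simps(1) pre] eval_Proj_simps(2)
            eval_pair_prog]]) (simp add: rev_map)
  show thesis
  proof (rule that[of "Comp u [Comp pair_prog [Comp pre [Mu ?b], Proj 0]]"])
    fix g n w
    assume w: "R (map g [0..<w]) n" "\<And>w'. w' < w \<Longrightarrow> \<not> R (map g [0..<w']) n"
    have "eval g (Mu ?b) [n] w"
      using b[of g w n] b[of g _ n] w by (intro eval_Mu) (auto, metis of_bool_eq(2) One_nat_def)
    then show "eval g (Comp u [Comp pair_prog [Comp pre [Mu ?b], Proj 0]]) [n] (U (map g [0..<w]) n)"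
      using u[of g "(rev (map g [0..<w]), n)"] unfolding encode_prod_def
      by (intro eval_Comp1[OF eval_Comp2[OF eval_Comp1[OF _ pre] eval_Proj_simps(1) eval_pair_prog]])
        (auto simp: rev_map)
  qed
qed

section \<open>Finite strings and blocks\<close>

definition binary :: "(nat \<Rightarrow> nat) \<Rightarrow> bool" where
  "binary f \<longleftrightarrow> (\<forall>k. f k \<in> {0, 1})"

definition strings :: "nat \<Rightarrow> nat list set" where
  "strings L = {\<sigma>. length \<sigma> = L \<and> set \<sigma> \<subseteq> {0, 1}}"

lemma finite_strings [simp]: "finite (strings L)"
  unfolding strings_def using finite_lists_length_eq[of "{0, 1 :: nat}" L] by (simp add: conj_commute)

lemma card_strings [simp]: "card (strings L) = 2 ^ L"
  unfolding strings_def using card_lists_length_eq[of "{0, 1 :: nat}" L] by (simp add: conj_commute numeral_2_eq_2)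

lemma strings_append: "\<sigma> \<in> strings k \<Longrightarrow> \<rho> \<in> strings l \<Longrightarrow> \<sigma> @ \<rho> \<in> strings (k + l)"
  by (auto simp: strings_def)

lemma map_upt_in_strings: "binary f \<Longrightarrow> map f [k..<l] \<in> strings (l - k)"
  by (auto simp: binary_def strings_def image_subset_iff)

primrec all_strings :: "nat \<Rightarrow> nat list list" where
  "all_strings 0 = [[]]"
| "all_strings (Suc L) = map (\<lambda>\<sigma>. 0 # \<sigma>) (all_strings L) @ map (\<lambda>\<sigma>. 1 # \<sigma>) (all_strings L)"

lemma set_all_strings [simp]: "set (all_strings L) = strings L"
proof (induction L)
  case (Suc L)
  have "strings (Suc L) = (\<lambda>\<sigma>. 0 # \<sigma>) ` strings L \<union> (\<lambda>\<sigma>. 1 # \<sigma>) ` strings L"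
  proof (intro set_eqI iffI)
    fix \<sigma> assume "\<sigma> \<in> strings (Suc L)"
    then show "\<sigma> \<in> (\<lambda>\<sigma>. 0 # \<sigma>) ` strings L \<union> (\<lambda>\<sigma>. 1 # \<sigma>) ` strings L"
      by (cases \<sigma>) (auto simp: strings_def)
  qed (auto simp: strings_def)
  with Suc show ?case by simp
qed (auto simp: strings_def)

lemma distinct_all_strings: "distinct (all_strings L)"
  by (induction L) (auto simp: distinct_map inj_on_def)

lemma recursive_all_strings [recursive_intros]:
  assumes "recursive F"
  shows "recursive (\<lambda>x. all_strings (F x))"
proof -
  have "all_strings L = rec_nat [[]] (\<lambda>_ l. map (\<lambda>\<sigma>. 0 # \<sigma>) l @ map (\<lambda>\<sigma>. 1 # \<sigma>) l) L" for L
    by (induction L) simp_all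
  then show ?thesis
    by (simp only:) (intro recursive_intros assms)
qed

definition block :: "nat \<Rightarrow> nat list \<Rightarrow> nat list" where
  "block n \<sigma> = take (3 * 4 ^ n) (drop (4 ^ n) \<sigma>)"

definition fblock :: "nat \<Rightarrow> (nat \<Rightarrow> nat) \<Rightarrow> nat list" where
  "fblock n f = map f [4 ^ n..<4 ^ Suc n]"

lemma fblock_in_strings: "binary f \<Longrightarrow> fblock n f \<in> strings (3 * 4 ^ n)"
  using map_upt_in_strings[of f "4 ^ n" "4 ^ Suc n"] by (simp add: fblock_def)

lemma block_append: "4 ^ Suc n \<le> length \<sigma> \<Longrightarrow> block n (\<sigma> @ \<rho>) = block n \<sigma>"
  by (simp add: block_def)

lemma block_append_exact:
  "length \<sigma> = 4 ^ n \<Longrightarrow> length \<beta> = 3 * 4 ^ n \<Longrightarrow> block n (\<sigma> @ \<beta> @ \<rho>) = \<beta>"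
  by (simp add: block_def)

lemma block_map_upt: "4 ^ Suc n \<le> t \<Longrightarrow> block n (map f [0..<t]) = fblock n f"
  by (simp add: block_def fblock_def drop_map take_map)

lemma map_upt_0_eq_iff: "map f [0..<n] = \<sigma> \<longleftrightarrow> length \<sigma> = n \<and> (\<forall>k<n. f k = \<sigma> ! k)"
  by (auto simp: list_eq_iff_nth_eq)

lemma recursive_block [recursive_intros]:
  assumes "recursive F" "recursive G"
  shows "recursive (\<lambda>x. block (F x) (G x))"
  unfolding block_def by (intro recursive_intros assms)

lemma weak_koenig:
  assumes closed: "\<And>\<sigma> \<tau>. \<sigma> \<in> T \<Longrightarrow> Sublist.prefix \<tau> \<sigma> \<Longrightarrow> \<tau> \<in> T"
    and bin: "\<And>\<sigma>. \<sigma> \<in> T \<Longrightarrow> set \<sigma> \<subseteq> {0, 1 :: nat}"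
    and long: "\<And>L. \<exists>\<sigma>\<in>T. L \<le> length \<sigma>"
  shows "\<exists>f. \<forall>n. map f [0..<n] \<in> T"
proof -
  \<comment> \<open>These strings have arbitrarily long extensions in \<open>T\<close>. Each has a
    one-digit extension of the same sort, and repeated choice yields the path.\<close>
  define big where "big = (\<lambda>\<sigma>. \<forall>L. \<exists>\<tau>\<in>T. L \<le> length \<tau> \<and> Sublist.prefix \<sigma> \<tau>)"
  have big_step: "\<exists>b. big (\<sigma> @ [b])" if big: "big \<sigma>" for \<sigma>
  proof (rule ccontr)
    assume "\<nexists>b. big (\<sigma> @ [b])"
    then obtain L where L: "\<And>b \<tau>. \<tau> \<in> T \<Longrightarrow> L b \<le> length \<tau> \<Longrightarrow> \<not> Sublist.prefix (\<sigma> @ [b]) \<tau>"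
      unfolding big_def by metis
    \<comment> \<open>The length exceeds both bounds at once and forces a proper extension of
      \<open>\<sigma>\<close>.\<close>
    obtain \<tau> where \<tau>: "\<tau> \<in> T" "L 0 + L 1 + length \<sigma> + 1 \<le> length \<tau>" "Sublist.prefix \<sigma> \<tau>"
      using big unfolding big_def by blast
    then obtain b \<rho> where b: "\<tau> = \<sigma> @ b # \<rho>"
      by (metis Suc_eq_plus1 add_leE append_Nil2 neq_Nil_conv not_less_eq_eq prefixE)
    with bin[OF \<tau>(1)] have "b = 0 \<or> b = 1" by auto
    moreover have "Sublist.prefix (\<sigma> @ [b]) \<tau>" by (simp add: b)
    ultimately show False using L[of \<tau> b] \<tau> by auto
  qed
  define s where "s = rec_nat [] (\<lambda>_ \<sigma>. \<sigma> @ [SOME b. big (\<sigma> @ [b])])"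
  define f where "f n = (SOME b. big (s n @ [b]))" for n
  have s: "s n = map f [0..<n]" for n
    by (induction n) (auto simp: s_def f_def)
  have "big (s n)" for n
  proof (induction n)
    case 0
    show ?case using long by (simp add: s big_def)
  next
    case (Suc n)
    from someI_ex[OF big_step[OF Suc]] show ?case by (simp add: s_def)
  qed
  then have "map f [0..<n] \<in> T" for n
    using closed unfolding big_def s by blast
  then show ?thesis by blast
qed


section \<open>The forbidden blocks\<close>

text \<open>
  A number \<open>n\<close> codes a kind, the code of a program and a padding parameter. The program is
  diagonalised against on block \<open>n\<close>: for every string \<open>\<tau>\<close> of length \<open>4 ^ n\<close>, at most one
  value \<open>v\<close> is forbidden, namely the first one that the program is seen to output on a
  fraction of more than \<open>2 ^ -(5 * 4 ^ n)\<close> of the oracles that extend \<open>\<tau>\<close> and vanish on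
  block \<open>n\<close>.
\<close>

definition "kind n = fst (decode n :: nat \<times> nat \<times> nat)"
definition "prog_of n = fst (snd (decode n :: nat \<times> nat \<times> nat))"

definition stem :: "nat \<Rightarrow> nat list \<Rightarrow> nat list" where
  "stem n \<tau> = \<tau> @ replicate (3 * 4 ^ n) 0"

text \<open>The stage \<open>s\<close> bounds both the running time and the oracle length: the
  strings \<open>\<rho>\<close> fill exactly the \<open>s\<close> blocks that follow block
  \<open>n\<close>.\<close>

definition hits :: "nat \<Rightarrow> nat list \<Rightarrow> nat \<Rightarrow> nat list \<Rightarrow> nat" where
  "hits n \<tau> s v = length (filter (\<lambda>\<rho>. run (stem n \<tau> @ \<rho>) s (prog_of n) n (encode v))
     (all_strings (4 ^ (Suc n + s) - 4 ^ Suc n)))"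

definition candidate :: "nat \<Rightarrow> nat list \<Rightarrow> nat \<Rightarrow> nat list \<Rightarrow> bool" where
  "candidate n \<tau> s v \<longleftrightarrow> v \<in> set (all_strings (3 * 4 ^ n)) \<and>
     2 ^ (4 ^ (Suc n + s) - 4 ^ Suc n) < hits n \<tau> s v * 2 ^ (5 * 4 ^ n)"

definition first_candidate :: "nat \<Rightarrow> nat list \<Rightarrow> nat \<Rightarrow> bool" where
  "first_candidate n \<tau> w \<longleftrightarrow>
     candidate n \<tau> (fst (decode w :: nat \<times> nat list)) (snd (decode w :: nat \<times> nat list)) \<and>
     (\<forall>w'<w. \<not> candidate n \<tau> (fst (decode w' :: nat \<times> nat list)) (snd (decode w' :: nat \<times> nat list)))"

text \<open>The witness \<open>w\<close> codes a stage together with a value. For fixed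
  \<open>w\<close> the relation is decidable, so quantifying over \<open>w\<close> makes
  \<open>forbidden\<close> c.e.\<close>

definition forbidden_at :: "nat \<Rightarrow> nat \<Rightarrow> nat list \<Rightarrow> bool" where
  "forbidden_at w n v \<longleftrightarrow> snd (decode w :: nat \<times> nat list) = v \<and>
     (\<exists>\<tau>\<in>set (all_strings (4 ^ n)). first_candidate n \<tau> w)"

definition forbidden :: "nat \<Rightarrow> nat list set" where
  "forbidden n = {v. \<exists>w. forbidden_at w n v}"

lemma decidable_candidate:
  "decidable (\<lambda>z. candidate (fst z) (fst (snd z)) (fst (snd (snd z))) (snd (snd (snd z))))"
  unfolding candidate_def hits_def stem_def prog_of_def by (intro recursive_intros)

lemma decidable_candidate_comp [recursive_intros]:
  assumes "recursive A" "recursive B" "recursive C" "recursive D"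
  shows "decidable (\<lambda>x. candidate (A x) (B x) (C x) (D x))"
  using decidable_comp[OF decidable_candidate, of "\<lambda>x. (A x, B x, C x, D x)", unfolded fst_conv snd_conv]
  by (simp add: recursive_intros assms)

lemma decidable_forbidden_at [recursive_intros]:
  assumes "recursive A" "recursive B" "recursive C"
  shows "decidable (\<lambda>x. forbidden_at (A x) (B x) (C x))"
proof -
  have "decidable (\<lambda>z. forbidden_at (fst z) (fst (snd z)) (snd (snd z)))"
    unfolding forbidden_at_def first_candidate_def by (intro recursive_intros)
  from decidable_comp[OF this, of "\<lambda>x. (A x, B x, C x)", unfolded fst_conv snd_conv]
  show ?thesis by (simp add: recursive_intros assms)
qed

lemma first_candidate_unique: "first_candidate n \<tau> w \<Longrightarrow> first_candidate n \<tau> w' \<Longrightarrow> w = w'"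
  unfolding first_candidate_def by (metis linorder_neqE_nat)

lemma forbidden_subset: "forbidden n \<subseteq> strings (3 * 4 ^ n)"
  by (auto simp: forbidden_def forbidden_at_def first_candidate_def candidate_def)

lemma card_forbidden: "card (forbidden n) \<le> 2 ^ 4 ^ n"
proof -
  have "forbidden n \<subseteq> (\<lambda>\<tau>. snd (decode (THE w. first_candidate n \<tau> w) :: nat \<times> nat list)) ` strings (4 ^ n)"
  proof
    fix v assume "v \<in> forbidden n"
    then obtain w \<tau> where "snd (decode w :: nat \<times> nat list) = v" "\<tau> \<in> strings (4 ^ n)" "first_candidate n \<tau> w"
      by (auto simp: forbidden_def forbidden_at_def)
    moreover from this(3) have "(THE w. first_candidate n \<tau> w) = w"
      using first_candidate_unique by blast
    ultimately show "v \<in> (\<lambda>\<tau>. snd (decode (THE w. first_candidate n \<tau> w) :: nat \<times> nat list)) ` strings (4 ^ n)"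
      by blast
  qed
  then have "card (forbidden n) \<le> card (strings (4 ^ n))"
    by (intro surj_card_le) auto
  then show ?thesis by simp
qed

lemma finite_forbidden [simp]: "finite (forbidden n)"
  using forbidden_subset by (rule finite_subset) simp

lemma ex_allowed: "\<exists>\<beta>\<in>strings (3 * 4 ^ n). \<beta> \<notin> forbidden n"
proof (rule ccontr)
  assume "\<not> ?thesis"
  then have "card (strings (3 * 4 ^ n)) \<le> card (forbidden n)"
    by (intro card_mono) auto
  also have "\<dots> < 2 ^ (3 * 4 ^ n)"
    by (rule le_less_trans[OF card_forbidden]) simp
  finally show False by simp
qed

text \<open>Blocks are contiguous and \<open>forbidden\<close> ignores the past, so a string ending
  at a block boundary can be continued by allowed contents chosen independently.\<close>

lemma extend_avoiding:
  assumes "\<sigma> \<in> strings (4 ^ N)"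
  obtains g where "binary g" "map g [0..<4 ^ N] = \<sigma>" "\<And>m. N \<le> m \<Longrightarrow> fblock m g \<notin> forbidden m"
proof -
  obtain \<beta> where \<beta>: "\<And>m. \<beta> m \<in> strings (3 * 4 ^ m)" "\<And>m. \<beta> m \<notin> forbidden m"
    using ex_allowed by metis
  define e where "e = rec_nat \<sigma> (\<lambda>j \<rho>. \<rho> @ \<beta> (N + j))"
  have e_Suc: "e (Suc j) = e j @ \<beta> (N + j)" for j
    by (simp add: e_def)
  have e: "e j \<in> strings (4 ^ (N + j))" for j
  proof (induction j)
    case (Suc j)
    from strings_append[OF this \<beta>(1)[of "N + j"]] show ?case by (simp add: e_Suc)
  qed (simp add: e_def assms)
  then have len: "length (e j) = 4 ^ (N + j)" for j
    by (simp add: strings_def)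
  have mono: "Sublist.prefix (e i) (e j)" if "i \<le> j" for i j
    using that by (induction rule: dec_induct) (auto simp: e_Suc intro: prefix_order.trans)
  have long: "k < length (e k)" for k
    unfolding len by (induction k) auto
  \<comment> \<open>Digit \<open>k\<close> of the limit is already settled in \<open>e k\<close>,
    whose length exceeds \<open>k\<close>.\<close>
  define g where "g k = e k ! k" for k
  have nth_e: "e j ! k = g k" if k: "k < length (e j)" for j k
  proof (cases "j \<le> k")
    case True
    from mono[OF this] k show ?thesis by (auto simp: g_def prefix_def nth_append)
  next
    case False
    then have "Sublist.prefix (e k) (e j)" by (intro mono) simp
    with long[of k] show ?thesis by (auto simp: g_def prefix_def nth_append)
  qed
  have pre: "map g [0..<4 ^ (N + j)] = e j" for j
    unfolding map_upt_0_eq_iff by (auto simp: len nth_e)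
  show thesis
  proof (rule that)
    show "binary g"
      unfolding binary_def g_def
    proof
      fix k
      have "e k ! k \<in> set (e k)" using long by (rule nth_mem)
      with e[of k] show "e k ! k \<in> {0, 1}" by (auto simp: strings_def)
    qed
    show "map g [0..<4 ^ N] = \<sigma>"
      using pre[of 0] by (simp add: e_def)
    fix m assume "N \<le> m"
    then obtain j where m: "m = N + j" using le_Suc_ex by blast
    have "fblock m g = block m (e (Suc j))"
      using block_map_upt[of m "4 ^ Suc m" g] pre[of "Suc j"] by (simp add: m)
    also have "\<dots> = \<beta> m"
      using block_append_exact[of "e j" m "\<beta> m" "[]"] \<beta>(1)[of m] len[of j]
      by (simp add: e_Suc m strings_def)
    finally show "fblock m g \<notin> forbidden m" using \<beta>(2) by simp
  qed
qed

section \<open>Counting the extensions whose later blocks are all allowed, whatever their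
  kind\<close>

definition good :: "nat list \<Rightarrow> nat \<Rightarrow> nat \<Rightarrow> nat list set" where
  "good \<pi> n N = {\<rho> \<in> strings (4 ^ N - 4 ^ Suc n). \<forall>m. n < m \<and> m < N \<longrightarrow> block m (\<pi> @ \<rho>) \<notin> forbidden m}"

lemma finite_good [simp]: "finite (good \<pi> n N)"
  unfolding good_def by simp

lemma good_subset: "good \<pi> n N \<subseteq> strings (4 ^ N - 4 ^ Suc n)"
  unfolding good_def by blast

lemma four_power_mono: "n < N \<Longrightarrow> (4 :: nat) ^ Suc n \<le> 4 ^ N"
  by (intro power_increasing) auto

lemma good_append_iff:
  assumes "length \<pi> = 4 ^ Suc n" "n < N" "\<rho> \<in> strings (4 ^ N - 4 ^ Suc n)" "\<beta> \<in> strings (3 * 4 ^ N)"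
  shows "\<rho> @ \<beta> \<in> good \<pi> n (Suc N) \<longleftrightarrow> \<rho> \<in> good \<pi> n N \<and> \<beta> \<notin> forbidden N"
proof -
  have len: "length (\<pi> @ \<rho>) = 4 ^ N"
    using assms four_power_mono[OF assms(2)] by (simp add: strings_def)
  have "\<rho> @ \<beta> \<in> strings (4 ^ Suc N - 4 ^ Suc n)"
    using strings_append[OF assms(3,4)] four_power_mono[OF assms(2)] by simp
  moreover have "block m (\<pi> @ \<rho> @ \<beta>) = block m (\<pi> @ \<rho>)" if "m < N" for m
    using block_append[of m "\<pi> @ \<rho>" \<beta>] len four_power_mono[OF that] by simp
  moreover have "block N (\<pi> @ \<rho> @ \<beta>) = \<beta>"
    using block_append_exact[OF len, of \<beta> "[]"] assms(4) by (simp add: strings_def)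
  ultimately show ?thesis
    using assms(2,3) by (auto simp: good_def less_Suc_eq)
qed

lemma strings_split:
  assumes "\<sigma> \<in> strings (k + l)"
  shows "take k \<sigma> \<in> strings k" "drop k \<sigma> \<in> strings l"
  using assms by (auto simp: strings_def dest: in_set_takeD in_set_dropD)

text \<open>Whether block \<open>N\<close> is forbidden depends on its content alone, so the number
  of good extensions is an exact product.\<close>

lemma card_good_Suc:
  assumes "length \<pi> = 4 ^ Suc n" "n < N"
  shows "card (good \<pi> n (Suc N)) = card (good \<pi> n N) * (2 ^ (3 * 4 ^ N) - card (forbidden N))"
proof -
  let ?k = "4 ^ N - 4 ^ Suc n :: nat"
  have len: "4 ^ Suc N - 4 ^ Suc n = ?k + (3 * 4 ^ N :: nat)"
    using four_power_mono[OF assms(2)] by simp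
  have "bij_betw (\<lambda>(\<rho>, \<beta>). \<rho> @ \<beta>) (good \<pi> n N \<times> (strings (3 * 4 ^ N) - forbidden N)) (good \<pi> n (Suc N))"
  proof (rule bij_betw_byWitness[of _ "\<lambda>\<sigma>. (take ?k \<sigma>, drop ?k \<sigma>)"])
    show "\<forall>a\<in>good \<pi> n N \<times> (strings (3 * 4 ^ N) - forbidden N).
        (take ?k (case a of (\<rho>, \<beta>) \<Rightarrow> \<rho> @ \<beta>), drop ?k (case a of (\<rho>, \<beta>) \<Rightarrow> \<rho> @ \<beta>)) = a"
      by (auto simp: good_def strings_def)
    show "(\<lambda>(\<rho>, \<beta>). \<rho> @ \<beta>) ` (good \<pi> n N \<times> (strings (3 * 4 ^ N) - forbidden N)) \<subseteq> good \<pi> n (Suc N)"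
      using good_append_iff[OF assms] good_subset by fastforce
    show "(\<lambda>\<sigma>. (take ?k \<sigma>, drop ?k \<sigma>)) ` good \<pi> n (Suc N) \<subseteq> good \<pi> n N \<times> (strings (3 * 4 ^ N) - forbidden N)"
    proof (intro image_subsetI)
      fix \<sigma> assume \<sigma>: "\<sigma> \<in> good \<pi> n (Suc N)"
      then have "\<sigma> \<in> strings (?k + 3 * 4 ^ N)"
        using good_subset[of \<pi> n "Suc N"] len by auto
      from strings_split[OF this] good_append_iff[OF assms, of "take ?k \<sigma>" "drop ?k \<sigma>"] \<sigma>
      show "(take ?k \<sigma>, drop ?k \<sigma>) \<in> good \<pi> n N \<times> (strings (3 * 4 ^ N) - forbidden N)"
        by simp
    qed
  qed auto
  then have "card (good \<pi> n (Suc N)) = card (good \<pi> n N \<times> (strings (3 * 4 ^ N) - forbidden N))"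
    by (rule bij_betw_same_card[symmetric])
  then show ?thesis
    using forbidden_subset[of N] by (simp add: card_cartesian_product card_Diff_subset)
qed

lemma card_good:
  assumes "length \<pi> = 4 ^ Suc n" "n < N"
  shows "(1 - (1 / 2) ^ (5 * 4 ^ n)) * 2 ^ (4 ^ N - 4 ^ Suc n) \<le> real (card (good \<pi> n N))"
proof -
  define \<delta> :: real where "\<delta> = (1 / 2) ^ (5 * 4 ^ n)"
  define W :: "nat \<Rightarrow> real" where "W N = 2 ^ (4 ^ N - 4 ^ Suc n)" for N
  \<comment> \<open>The deduction starts at 0 and tends to \<open>\<delta>\<close> geometrically:
    each new block may use up half of what remains. The bare bound with \<open>\<delta>\<close>
    would not pass through the induction.\<close>
  have "(1 - \<delta> * (1 - (1 / 2) ^ (N - Suc n))) * W N \<le> card (good \<pi> n N)"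
    using assms(2)[THEN Suc_leI]
  proof (induction N rule: dec_induct)
    case base
    have "good \<pi> n (Suc n) = {[]}" by (auto simp: good_def strings_def)
    then show ?case by (simp add: W_def)
  next
    case (step N)
    then have N: "n < N" by simp
    define \<mu> :: real where "\<mu> = (1 / 2) ^ (2 * 4 ^ N)"
    have W_Suc: "W (Suc N) = W N * 2 ^ (3 * 4 ^ N)"
      using four_power_mono[OF N] by (simp add: W_def flip: power_add)
    have "card (good \<pi> n N) \<le> card (strings (4 ^ N - 4 ^ Suc n))"
      by (intro card_mono good_subset) simp
    then have le: "card (good \<pi> n N) \<le> W N"
      by (simp add: W_def)
    \<comment> \<open>As \<open>n < N\<close>, the term 5 * 4^n is at most 5/4 of 4^N, and N - n is
      less than half of 4^N.\<close>
    have "2 * 4 ^ N \<ge> 5 * 4 ^ n + (N - n)"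
    proof -
      have "4 * 4 ^ n \<le> (4 :: nat) ^ N" using four_power_mono[OF N] by simp
      moreover have "2 * N + 1 \<le> 4 ^ N" by (induction N) auto
      ultimately show ?thesis by linarith
    qed
    then have "\<mu> \<le> (1 / 2) ^ (5 * 4 ^ n + (N - n))"
      unfolding \<mu>_def by (intro power_decreasing) auto
    also have "N - n = Suc (N - Suc n)" using N by simp
    finally have \<mu>: "\<mu> \<le> \<delta> * (1 / 2) ^ (N - Suc n) / 2"
      by (simp add: \<delta>_def power_add)
    have "card (forbidden N) \<le> \<mu> * 2 ^ (3 * 4 ^ N)"
    proof -
      have "real (card (forbidden N)) \<le> 2 ^ 4 ^ N"
        using card_forbidden[of N] by (metis of_nat_le_iff of_nat_numeral of_nat_power)
      also have "\<dots> = \<mu> * 2 ^ (2 * 4 ^ N + 4 ^ N)"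
        unfolding \<mu>_def power_add by (simp add: power_one_over)
      finally show ?thesis by simp
    qed
    moreover have "card (forbidden N) \<le> 2 ^ (3 * 4 ^ N)"
      by (rule order_trans[OF card_forbidden]) simp
    ultimately have F: "(1 - \<mu>) * 2 ^ (3 * 4 ^ N) \<le> real (2 ^ (3 * 4 ^ N) - card (forbidden N))"
      by (simp add: algebra_simps)
    have "(1 - \<delta> * (1 - (1 / 2) ^ (Suc N - Suc n))) * W (Suc N) \<le>
        (1 - \<delta> * (1 - (1 / 2) ^ (N - Suc n)) - \<mu>) * W (Suc N)"
    proof (rule mult_right_mono)
      have half: "(1 / 2 :: real) ^ (Suc N - Suc n) = (1 / 2) ^ (N - Suc n) / 2"
        using N by (simp add: Suc_diff_Suc[symmetric])
      show "1 - \<delta> * (1 - (1 / 2) ^ (Suc N - Suc n)) \<le> 1 - \<delta> * (1 - (1 / 2) ^ (N - Suc n)) - \<mu>"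
        unfolding half using \<mu> by (simp add: algebra_simps)
    qed (simp add: W_def)
    also have "\<dots> = ((1 - \<delta> * (1 - (1 / 2) ^ (N - Suc n))) * W N - \<mu> * W N) * 2 ^ (3 * 4 ^ N)"
      by (simp add: W_Suc algebra_simps)
    also have "\<dots> \<le> (card (good \<pi> n N) - \<mu> * card (good \<pi> n N)) * 2 ^ (3 * 4 ^ N)"
      using step.IH le by (intro mult_right_mono diff_mono mult_left_mono) (auto simp: \<mu>_def)
    also have "\<dots> = card (good \<pi> n N) * ((1 - \<mu>) * 2 ^ (3 * 4 ^ N))"
      by (simp add: algebra_simps)
    also have "\<dots> \<le> card (good \<pi> n N) * real (2 ^ (3 * 4 ^ N) - card (forbidden N))"
      using F by (intro mult_left_mono) auto
    finally show ?case by (simp add: card_good_Suc[OF assms(1) N])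
  qed
  moreover have "(1 - \<delta>) * W N \<le> (1 - \<delta> * (1 - (1 / 2) ^ (N - Suc n))) * W N"
    by (intro mult_right_mono) (auto simp: \<delta>_def W_def mult_left_le)
  ultimately have "(1 - \<delta>) * W N \<le> card (good \<pi> n N)" by linarith
  then show ?thesis unfolding \<delta>_def W_def .
qed

section \<open>Diagonalisation\<close>

lemma good_take:
  assumes "length \<pi> = 4 ^ Suc n" "\<rho> \<in> good \<pi> n N'" "n < N" "N \<le> N'"
  shows "take (4 ^ N - 4 ^ Suc n) \<rho> \<in> good \<pi> n N"
proof -
  let ?k = "4 ^ N - 4 ^ Suc n :: nat"
  have le: "4 ^ Suc n \<le> (4 :: nat) ^ N" "(4 :: nat) ^ N \<le> 4 ^ N'"
    using four_power_mono[OF assms(3)] power_increasing[OF assms(4), of "4 :: nat"] by simp_all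
  then have "4 ^ N' - 4 ^ Suc n = ?k + (4 ^ N' - 4 ^ N :: nat)"
    by simp
  with assms(2) have k: "take ?k \<rho> \<in> strings ?k"
    using strings_split(1)[of \<rho> ?k "4 ^ N' - 4 ^ N"] by (simp add: good_def)
  have "block m (\<pi> @ take ?k \<rho>) = block m (\<pi> @ \<rho>)" if "m < N" for m
    using block_append[of m "\<pi> @ take ?k \<rho>" "drop ?k \<rho>"] four_power_mono[OF that] k le assms(1)
    by (simp add: strings_def)
  with k assms show ?thesis
    by (auto simp: good_def)
qed

lemma stem_in_strings: "\<tau> \<in> strings (4 ^ n) \<Longrightarrow> stem n \<tau> \<in> strings (4 ^ Suc n)"
  using strings_append[of \<tau> "4 ^ n" "replicate (3 * 4 ^ n) 0" "3 * 4 ^ n"]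
  by (auto simp: stem_def strings_def)

lemma hits_eq_card:
  "hits n \<tau> s v = card {\<rho> \<in> strings (4 ^ (Suc n + s) - 4 ^ Suc n).
     run (stem n \<tau> @ \<rho>) s (prog_of n) n (encode v)}"
  unfolding hits_def by (subst distinct_length_filter) (auto simp: distinct_all_strings Int_def conj_commute)

lemma less_four_power: "k < (4 :: nat) ^ (m + k)"
  by (induction k) auto

text \<open>A stage that works for all good strings exists by compactness: otherwise the strings
  that fail at their stages have an infinite path of prefixes, and this path is an oracle to which
  \<open>conv\<close> applies.\<close>

lemma convergence_compact:
  assumes \<pi>: "\<pi> \<in> strings (4 ^ Suc n)"
    and conv: "\<And>g. binary g \<Longrightarrow> map g [0..<4 ^ Suc n] = \<pi> \<Longrightarrow>
      (\<And>m. n < m \<Longrightarrow> fblock m g \<notin> forbidden m) \<Longrightarrow> \<exists>v\<in>V. eval g p [n] (encode (v :: nat list))"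
  shows "\<exists>s. \<forall>\<rho>\<in>good \<pi> n (Suc n + s). \<exists>v\<in>V. run (\<pi> @ \<rho>) s (prog_code p) n (encode v)"
proof (rule ccontr)
  assume *: "\<not> ?thesis"
  have len: "length \<pi> = 4 ^ Suc n" using \<pi> by (simp add: strings_def)
  define B where "B s = (\<lambda>\<rho>. \<pi> @ \<rho>) ` {\<rho> \<in> good \<pi> n (Suc n + s).
    \<not> (\<exists>v\<in>V. run (\<pi> @ \<rho>) s (prog_code p) n (encode v))}" for s
  have B_strings: "\<sigma> \<in> strings (4 ^ (Suc n + s))" if "\<sigma> \<in> B s" for \<sigma> s
  proof -
    have "(4 :: nat) ^ Suc n \<le> 4 ^ (Suc n + s)" by (intro power_increasing) auto
    with that good_subset[of \<pi> n "Suc n + s"] strings_append[OF \<pi>, of _ "4 ^ (Suc n + s) - 4 ^ Suc n"]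
    show ?thesis unfolding B_def by (auto simp del: power_Suc)
  qed
  define T where "T = {\<sigma>. \<exists>s. \<exists>\<sigma>'\<in>B s. Sublist.prefix \<sigma> \<sigma>'}"
  have "\<exists>g. \<forall>k. map g [0..<k] \<in> T"
  proof (rule weak_koenig)
    fix \<sigma> \<tau> assume "\<sigma> \<in> T" "Sublist.prefix \<tau> \<sigma>"
    then show "\<tau> \<in> T" unfolding T_def using prefix_order.trans by blast
  next
    fix \<sigma> assume "\<sigma> \<in> T"
    then obtain s \<sigma>' where "\<sigma>' \<in> B s" "Sublist.prefix \<sigma> \<sigma>'" unfolding T_def by blast
    with B_strings show "set \<sigma> \<subseteq> {0, 1}" by (fastforce simp: strings_def dest: set_mono_prefix)
  next
    fix L
    from * obtain \<sigma> where "\<sigma> \<in> B L" unfolding B_def by blast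
    with B_strings[OF this] less_four_power[of L "Suc n"] show "\<exists>\<sigma>\<in>T. L \<le> length \<sigma>"
      by (intro bexI[of _ \<sigma>]) (auto simp: T_def strings_def intro!: exI[of _ L] bexI[of _ \<sigma>])
  qed
  then obtain g where g: "\<And>k. map g [0..<k] \<in> T" by blast
  \<comment> \<open>A priori \<open>g\<close> consists of prefixes of failing strings. Truncating
    such a string to an earlier stage gives a failing string again, because halting persists under
    longer oracles and larger bounds.\<close>
  have gB: "map g [0..<4 ^ (Suc n + s)] \<in> B s" for s
  proof -
    obtain s' \<sigma> where \<sigma>: "\<sigma> \<in> B s'" "Sublist.prefix (map g [0..<4 ^ (Suc n + s)]) \<sigma>"
      using g[of "4 ^ (Suc n + s)"] unfolding T_def by blast
    have "(4 :: nat) ^ (Suc n + s) \<le> 4 ^ (Suc n + s')"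
      using prefix_length_le[OF \<sigma>(2)] B_strings[OF \<sigma>(1)] by (simp add: strings_def)
    then have s: "s \<le> s'"
      by (metis add_le_cancel_left numeral_One numeral_less_iff power_increasing_iff semiring_norm(76))
    obtain \<rho> where \<rho>: "\<sigma> = \<pi> @ \<rho>" "\<rho> \<in> good \<pi> n (Suc n + s')"
      "\<And>v. v \<in> V \<Longrightarrow> \<not> run (\<pi> @ \<rho>) s' (prog_code p) n (encode v)"
      using \<sigma>(1) unfolding B_def by blast
    let ?\<rho> = "take (4 ^ (Suc n + s) - 4 ^ Suc n) \<rho>"
    have "(4 :: nat) ^ Suc n \<le> 4 ^ (Suc n + s)" by (intro power_increasing) auto
    then have "map g [0..<4 ^ (Suc n + s)] = \<pi> @ ?\<rho>"
      using \<sigma>(2) len unfolding \<rho>(1) by (auto simp: prefix_def append_eq_conv_conj take_map[symmetric] simp del: power_Suc)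
    moreover have "?\<rho> \<in> good \<pi> n (Suc n + s)"
      by (rule good_take[OF len \<rho>(2)]) (use s in auto)
    moreover have "\<not> run (\<pi> @ ?\<rho>) s (prog_code p) n (encode v)" if "v \<in> V" for v
    proof -
      have "Sublist.prefix (\<pi> @ ?\<rho>) (\<pi> @ \<rho>)" by (simp add: take_is_prefix)
      with \<rho>(3)[OF that] s show ?thesis using run_mono by blast
    qed
    ultimately show ?thesis unfolding B_def by auto
  qed
  have "binary g"
    unfolding binary_def
  proof
    fix k
    have "g k \<in> set (map g [0..<4 ^ (Suc n + k)])" using less_four_power[of k "Suc n"] by auto
    with B_strings[OF gB[of k]] show "g k \<in> {0, 1}" by (auto simp: strings_def)
  qed
  moreover have "map g [0..<4 ^ Suc n] = \<pi>"
    using gB[of 0] by (auto simp: B_def good_def strings_def simp del: power_Suc)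
  moreover have "fblock m g \<notin> forbidden m" if m: "n < m" for m
  proof -
    have "map g [0..<4 ^ Suc m] \<in> B (m - n)" using gB[of "m - n"] m by simp
    with m have "block m (map g [0..<4 ^ Suc m]) \<notin> forbidden m"
      by (auto simp: B_def good_def simp del: power_Suc)
    then show ?thesis by (simp add: block_map_upt del: power_Suc)
  qed
  ultimately obtain v where v: "v \<in> V" "eval g p [n] (encode v)" using conv by blast
  obtain u where "\<And>s t. u \<le> s \<Longrightarrow> u \<le> t \<Longrightarrow> run (map g [0..<t]) s (prog_code p) n (encode v)"
    using run_complete[OF v(2)] by blast
  then have "run (map g [0..<4 ^ (Suc n + u)]) u (prog_code p) n (encode v)"
    using less_four_power[of u "Suc n"] by simp
  with gB[of u] v(1) show False unfolding B_def by auto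
qed

lemma diagonalization:
  assumes p: "prog_of n = prog_code p" and f: "binary f"
    and conv: "\<And>g. binary g \<Longrightarrow> map g [0..<4 ^ n] = map f [0..<4 ^ n] \<Longrightarrow>
      (\<And>m. n < m \<Longrightarrow> fblock m g \<notin> forbidden m) \<Longrightarrow>
      \<exists>v\<in>strings (3 * 4 ^ n). eval g p [n] (encode v) \<and> v \<notin> forbidden n"
  shows False
proof -
  define \<tau> where "\<tau> = map f [0..<4 ^ n]"
  \<comment> \<open>\<open>conv\<close> leaves block \<open>n\<close> of the oracle free; filling it
    with zeros matches the stem on which \<open>hits\<close> counts.\<close>
  define \<pi> where "\<pi> = stem n \<tau>"
  define q :: nat where "q = 4 ^ n"
  have \<tau>: "\<tau> \<in> strings (4 ^ n)" using map_upt_in_strings[OF f, of 0 "4 ^ n"] by (simp add: \<tau>_def)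
  then have \<pi>: "\<pi> \<in> strings (4 ^ Suc n)" unfolding \<pi>_def by (rule stem_in_strings)
  then have len: "length \<pi> = 4 ^ Suc n" by (simp add: strings_def)
  have conv': "\<exists>v\<in>strings (3 * 4 ^ n). eval g p [n] (encode v) \<and> v \<notin> forbidden n"
    if g: "binary g" "map g [0..<4 ^ Suc n] = \<pi>" "\<And>m. n < m \<Longrightarrow> fblock m g \<notin> forbidden m" for g
  proof (rule conv[OF g(1) _ g(3)])
    have "map g [0..<4 ^ n] = take (4 ^ n) (map g [0..<4 ^ Suc n])"
      by (simp add: take_map)
    also have "\<dots> = \<tau>" unfolding g(2) \<pi>_def stem_def by (simp add: \<tau>_def)
    finally show "map g [0..<4 ^ n] = map f [0..<4 ^ n]" by (simp add: \<tau>_def)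
  qed
  have q: "0 < q" by (simp add: q_def)
  let ?W = "\<lambda>s. 2 ^ (4 ^ (Suc n + s) - 4 ^ Suc n) :: real"
  have card_good': "(2 ^ (5 * q) - 1) * ?W s \<le> real (card (good \<pi> n (Suc n + s))) * 2 ^ (5 * q)" for s
  proof -
    have "(1 - (1 / 2) ^ (5 * q)) * ?W s \<le> real (card (good \<pi> n (Suc n + s)))"
      using card_good[OF len, of "Suc n + s"] by (simp add: q_def del: power_Suc)
    then have "((1 - (1 / 2) ^ (5 * q)) * ?W s) * 2 ^ (5 * q) \<le> real (card (good \<pi> n (Suc n + s))) * 2 ^ (5 * q)"
      by (intro mult_right_mono) auto
    moreover have "((1 - (1 / 2) ^ (5 * q)) * ?W s) * 2 ^ (5 * q) = (2 ^ (5 * q) - 1) * ?W s"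
      by (simp add: algebra_simps power_one_over del: power_Suc)
    ultimately show ?thesis by linarith
  qed

  have "\<exists>s. \<forall>\<rho>\<in>good \<pi> n (Suc n + s). \<exists>v\<in>strings (3 * 4 ^ n). run (\<pi> @ \<rho>) s (prog_code p) n (encode v)"
    using conv' by (intro convergence_compact[OF \<pi>]) blast
  then obtain s where s: "\<And>\<rho>. \<rho> \<in> good \<pi> n (Suc n + s) \<Longrightarrow>
    \<exists>v\<in>strings (3 * 4 ^ n). run (\<pi> @ \<rho>) s (prog_code p) n (encode v)" by blast
  \<comment> \<open>Otherwise each of the 2^(3q) values takes at most 2^-(5q) of the oracles, so the
    good ones amount to at most 2^-(2q), against their proportion of at least 1 - 2^-(5q).\<close>
  have "\<exists>v. candidate n \<tau> s v"
  proof (rule ccontr)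
    assume "\<nexists>v. candidate n \<tau> s v"
    then have few: "hits n \<tau> s v * 2 ^ (5 * q) \<le> 2 ^ (4 ^ (Suc n + s) - 4 ^ Suc n)"
      if "v \<in> strings (3 * q)" for v
      using that unfolding candidate_def q_def by (auto simp: not_less simp del: power_Suc)
    have "good \<pi> n (Suc n + s) \<subseteq> (\<Union>v\<in>strings (3 * q). {\<rho> \<in> strings (4 ^ (Suc n + s) - 4 ^ Suc n).
        run (\<pi> @ \<rho>) s (prog_of n) n (encode v)})"
      using s good_subset[of \<pi> n "Suc n + s"] unfolding p q_def by blast
    then have "card (good \<pi> n (Suc n + s)) \<le> card (\<Union>v\<in>strings (3 * q). {\<rho> \<in> strings (4 ^ (Suc n + s) - 4 ^ Suc n).
        run (\<pi> @ \<rho>) s (prog_of n) n (encode v)})"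
      by (intro card_mono) auto
    also have "\<dots> \<le> (\<Sum>v\<in>strings (3 * q). hits n \<tau> s v)"
      unfolding hits_eq_card \<pi>_def by (rule card_UN_le) simp
    finally have "card (good \<pi> n (Suc n + s)) * 2 ^ (5 * q) \<le> (\<Sum>v\<in>strings (3 * q). hits n \<tau> s v * 2 ^ (5 * q))"
      by (simp flip: sum_distrib_right)
    also have "\<dots> \<le> (\<Sum>v\<in>strings (3 * q). 2 ^ (4 ^ (Suc n + s) - 4 ^ Suc n))"
      by (intro sum_mono few)
    also have "\<dots> = 2 ^ (3 * q) * 2 ^ (4 ^ (Suc n + s) - 4 ^ Suc n)"
      by simp
    finally have "real (card (good \<pi> n (Suc n + s)) * 2 ^ (5 * q)) \<le> real (2 ^ (3 * q) * 2 ^ (4 ^ (Suc n + s) - 4 ^ Suc n))"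
      by (simp only: of_nat_le_iff)
    then have "real (card (good \<pi> n (Suc n + s))) * 2 ^ (5 * q) \<le> 2 ^ (3 * q) * ?W s"
      by (simp only: of_nat_mult of_nat_power of_nat_numeral)
    with card_good'[of s] have "(2 ^ (5 * q) - 1) * ?W s \<le> 2 ^ (3 * q) * ?W s"
      by linarith
    then have "2 ^ (5 * q) - 1 \<le> (2 :: real) ^ (3 * q)"
      by (simp del: power_Suc)
    moreover have "(2 :: real) ^ (Suc (3 * q)) \<le> 2 ^ (5 * q)"
      using q by (intro power_increasing) auto
    moreover have "(1 :: real) < 2 ^ (3 * q)"
      using q by (intro one_less_power) auto
    ultimately show False by simp
  qed
  then obtain v where "candidate n \<tau> s v" by blast
  then have "candidate n \<tau> (fst (decode (encode (s, v)) :: nat \<times> nat list)) (snd (decode (encode (s, v)) :: nat \<times> nat list))"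
    by simp
  from exists_least_iff[THEN iffD1, OF exI, of "\<lambda>w. candidate n \<tau> (fst (decode w :: nat \<times> nat list)) (snd (decode w :: nat \<times> nat list))", OF this]
  obtain w where w: "first_candidate n \<tau> w"
    unfolding first_candidate_def by blast
  \<comment> \<open>The first candidate may differ in stage and value from the one just found. As
    \<open>v0\<close> is the value forbidden on account of \<open>\<tau>\<close>, the counting is
    repeated at stage \<open>s0\<close>.\<close>
  define s0 where "s0 = fst (decode w :: nat \<times> nat list)"
  define v0 where "v0 = snd (decode w :: nat \<times> nat list)"
  have v0: "v0 \<in> forbidden n"
    unfolding forbidden_def forbidden_at_def v0_def using w \<tau> by auto
  let ?S = "strings (4 ^ (Suc n + s0) - 4 ^ Suc n)"
  let ?H = "{\<rho> \<in> ?S. run (\<pi> @ \<rho>) s0 (prog_of n) n (encode v0)}"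
  have many: "?W s0 < real (card ?H) * 2 ^ (5 * q)"
  proof -
    have "2 ^ (4 ^ (Suc n + s0) - 4 ^ Suc n) < card ?H * 2 ^ (5 * q)"
      using w unfolding first_candidate_def candidate_def s0_def v0_def q_def hits_eq_card \<pi>_def by blast
    then have "real (2 ^ (4 ^ (Suc n + s0) - 4 ^ Suc n)) < real (card ?H * 2 ^ (5 * q))"
      by (simp only: of_nat_less_iff)
    then show ?thesis
      by (simp only: of_nat_mult of_nat_power of_nat_numeral)
  qed
  \<comment> \<open>More than 2^-(5q) of the strings output \<open>v0\<close>, and at most 2^-(5q)
    of them fail to be good; the strict inequality in \<open>candidate\<close> forces an
    overlap.\<close>
  have "?H \<inter> good \<pi> n (Suc n + s0) \<noteq> {}"
  proof
    assume "?H \<inter> good \<pi> n (Suc n + s0) = {}"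
    then have "card ?H + card (good \<pi> n (Suc n + s0)) = card (?H \<union> good \<pi> n (Suc n + s0))"
      by (intro card_Un_disjoint[symmetric]) auto
    also have "\<dots> \<le> card ?S"
      using good_subset[of \<pi> n "Suc n + s0"] by (intro card_mono) auto
    finally have "real (card ?H + card (good \<pi> n (Suc n + s0))) \<le> real (2 ^ (4 ^ (Suc n + s0) - 4 ^ Suc n))"
      unfolding card_strings by (simp only: of_nat_le_iff)
    then have "real (card ?H) + card (good \<pi> n (Suc n + s0)) \<le> ?W s0"
      by (simp only: of_nat_add of_nat_power of_nat_numeral)
    then have "(real (card ?H) + card (good \<pi> n (Suc n + s0))) * 2 ^ (5 * q) \<le> ?W s0 * 2 ^ (5 * q)"
      by (intro mult_right_mono) auto
    with card_good'[of s0] many show False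
      by (simp add: algebra_simps del: power_Suc)
  qed
  then obtain \<rho> where \<rho>: "\<rho> \<in> good \<pi> n (Suc n + s0)" "run (\<pi> @ \<rho>) s0 (prog_code p) n (encode v0)"
    unfolding p by blast
  have le: "(4 :: nat) ^ Suc n \<le> 4 ^ (Suc n + s0)" by (intro power_increasing) auto
  have \<rho>S: "\<rho> \<in> ?S" using \<rho>(1) good_subset by blast
  have "\<pi> @ \<rho> \<in> strings (4 ^ (Suc n + s0))"
    using strings_append[OF \<pi> \<rho>S] le by (simp del: power_Suc)
  then obtain g where g: "binary g" "map g [0..<4 ^ (Suc n + s0)] = \<pi> @ \<rho>"
    "\<And>m. Suc n + s0 \<le> m \<Longrightarrow> fblock m g \<notin> forbidden m"
    using extend_avoiding by blast
  have "map g [0..<4 ^ Suc n] = take (4 ^ Suc n) (map g [0..<4 ^ (Suc n + s0)])"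
    using le by (simp add: take_map del: power_Suc)
  then have "map g [0..<4 ^ Suc n] = \<pi>"
    unfolding g(2) using len by simp
  moreover have "fblock m g \<notin> forbidden m" if m: "n < m" for m
  proof (cases "m < Suc n + s0")
    case True
    have "fblock m g = block m (\<pi> @ \<rho>)"
      using block_map_upt[of m "4 ^ (Suc n + s0)" g] four_power_mono[OF True] unfolding g(2) by simp
    with True m \<rho>(1) show ?thesis by (auto simp: good_def)
  qed (use g(3) in auto)
  ultimately obtain v where v: "eval g p [n] (encode v)" "v \<notin> forbidden n"
    using conv'[OF g(1)] by blast
  have "eval g p [n] (encode v0)"
  proof (rule run_sound[OF \<rho>(2)])
    fix k assume "k < length (\<pi> @ \<rho>)"
    with g(2) show "g k = (\<pi> @ \<rho>) ! k" by (metis map_upt_0_eq_iff)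
  qed
  with v(1) have "v = v0"
    using eval_deterministic encode_eq_iff by blast
  with v(2) v0 show False by simp
qed

section \<open>The two classes\<close>

definition avoiding :: "nat \<Rightarrow> (nat \<Rightarrow> nat) set" where
  "avoiding c = {g. binary g \<and> (\<forall>n. kind n \<noteq> c \<longrightarrow> fblock n g \<notin> forbidden n)}"

definition index :: "nat \<Rightarrow> prog \<Rightarrow> nat \<Rightarrow> nat" where
  "index c p j = encode (c, prog_code p, j)"

lemma index_simps [simp]: "kind (index c p j) = c" "prog_of (index c p j) = prog_code p"
  by (simp_all add: index_def kind_def prog_of_def)

text \<open>Padding moves the block for a given program beyond any prescribed finite part of the
  oracle.\<close>

lemma le_index: "j \<le> index c p j"
  unfolding index_def encode_prod_def snd_conv encode_nat_def
  by (rule order_trans[OF le_prod_encode_2 le_prod_encode_2])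

lemma computable_strings_iff_decidable: "computable_strings T \<longleftrightarrow> decidable (\<lambda>\<sigma>. \<sigma> \<in> T)"
proof -
  have "(\<forall>n. eval (\<lambda>_. 0) p [n] (if list_decode n \<in> T then 1 else 0)) \<longleftrightarrow>
      (\<forall>g \<sigma>. eval g p [encode \<sigma>] (encode (of_bool (\<sigma> \<in> T) :: nat)))" if "oracle_free p" for p
  proof
    assume p: "\<forall>n. eval (\<lambda>_. 0) p [n] (if list_decode n \<in> T then 1 else 0)"
    show "\<forall>g \<sigma>. eval g p [encode \<sigma>] (encode (of_bool (\<sigma> \<in> T) :: nat))"
    proof (intro allI)
      fix g \<sigma>
      \<comment> \<open>On lists of numbers the class coding coincides with the coding of strings
        used in \<open>computable_strings\<close>.\<close>
      have "encode \<sigma> = list_encode \<sigma>" by (simp add: encode_list_def encode_nat_def[abs_def])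
      with p[rule_format, of "encode \<sigma>"] that show "eval g p [encode \<sigma>] (encode (of_bool (\<sigma> \<in> T) :: nat))"
        by (simp add: of_bool_def eval_oracle_free)
    qed
  next
    assume p: "\<forall>g \<sigma>. eval g p [encode \<sigma>] (encode (of_bool (\<sigma> \<in> T) :: nat))"
    show "\<forall>n. eval (\<lambda>_. 0) p [n] (if list_decode n \<in> T then 1 else 0)"
    proof
      fix n
      have "encode (list_decode n) = n" by (simp add: encode_list_def encode_nat_def[abs_def])
      then show "eval (\<lambda>_. 0) p [n] (if list_decode n \<in> T then 1 else 0)"
        using p[rule_format, of "\<lambda>_. 0" "list_decode n"] by (simp add: of_bool_def)
    qed
  qed
  then show ?thesis
    unfolding computable_strings_def computable_def decidable_def recursive_def by blast
qed

lemma paths_iff: "g \<in> paths T \<longleftrightarrow> (\<forall>n. map g [0..<n] \<in> T)"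
  by (simp add: paths_def subsequence_def)

lemma Pi01_avoiding: "Pi01 (avoiding c)"
proof -
  \<comment> \<open>Being forbidden is only c.e., so a string is discarded once its length exceeds a
    witness \<open>w\<close>. The bounds on \<open>n\<close> and \<open>w\<close> grow with the
    string, which makes \<open>T\<close> closed under prefixes, and along a path every violation is
    eventually seen.\<close>
  define T where "T = {\<sigma>. (\<forall>x\<in>set \<sigma>. x \<le> 1) \<and> (\<forall>n<length \<sigma>. \<forall>w<length \<sigma>.
    4 ^ Suc n \<le> length \<sigma> \<and> kind n \<noteq> c \<longrightarrow> \<not> forbidden_at w n (block n \<sigma>))}"
  have "computable_tree T"
    unfolding computable_tree_def
  proof (intro conjI ballI allI impI)
    show "set \<sigma> \<subseteq> {0, 1}" if "\<sigma> \<in> T" for \<sigma>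
      using that by (auto simp: T_def le_Suc_eq)
    show "\<tau> \<in> T" if \<sigma>: "\<sigma> \<in> T" and pre: "Sublist.prefix \<tau> \<sigma>" for \<sigma> \<tau>
    proof -
      obtain \<rho> where \<rho>: "\<sigma> = \<tau> @ \<rho>" using pre by (rule prefixE)
      show ?thesis
        unfolding T_def mem_Collect_eq
      proof (intro conjI allI impI notI)
        show "\<forall>x\<in>set \<tau>. x \<le> 1" using \<sigma> by (simp add: T_def \<rho>)
        fix n w
        assume n: "n < length \<tau>" "w < length \<tau>" "4 ^ Suc n \<le> length \<tau> \<and> kind n \<noteq> c"
          and "forbidden_at w n (block n \<tau>)"
        then have "forbidden_at w n (block n \<sigma>)" by (simp add: \<rho> block_append del: power_Suc)
        moreover have "n < length \<sigma>" "w < length \<sigma>" "4 ^ Suc n \<le> length \<sigma>"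
          using n by (auto simp: \<rho> simp del: power_Suc)
        ultimately show False using \<sigma> n(3) unfolding T_def by blast
      qed
    qed
    show "computable_strings T"
      unfolding computable_strings_iff_decidable T_def mem_Collect_eq kind_def
      by (intro recursive_intros)
  qed
  moreover have "avoiding c = paths T"
  proof (intro set_eqI iffI)
    fix g assume g: "g \<in> avoiding c"
    show "g \<in> paths T"
      unfolding paths_iff T_def mem_Collect_eq
    proof (intro allI conjI impI)
      fix t
      show "\<forall>x\<in>set (map g [0..<t]). x \<le> 1"
        using g by (auto simp: avoiding_def binary_def) (metis One_nat_def le_less zero_le)
      fix n w
      assume "4 ^ Suc n \<le> length (map g [0..<t]) \<and> kind n \<noteq> c"
      then show "\<not> forbidden_at w n (block n (map g [0..<t]))"
        using g by (auto simp: avoiding_def block_map_upt forbidden_def simp del: power_Suc)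
    qed
  next
    fix g assume g: "g \<in> paths T"
    show "g \<in> avoiding c"
      unfolding avoiding_def mem_Collect_eq
    proof (intro conjI allI impI notI)
      have "g k \<le> 1" for k
        using g[unfolded paths_iff, rule_format, of "Suc k"] by (simp add: T_def)
      then show "binary g"
        by (auto simp: binary_def le_Suc_eq)
      fix n assume n: "kind n \<noteq> c" "fblock n g \<in> forbidden n"
      then obtain w where w: "forbidden_at w n (fblock n g)" by (auto simp: forbidden_def)
      obtain t where t: "4 ^ Suc n \<le> t" "n < t" "w < t"
        using that[of "4 ^ Suc n + Suc n + Suc w"] by simp
      have "map g [0..<t] \<in> T" using g unfolding paths_iff by blast
      with t w n(1) show False
        unfolding T_def block_map_upt[OF t(1), symmetric] by (auto simp del: power_Suc)
    qed
  qed
  ultimately show ?thesis unfolding Pi01_def by blast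
qed

lemma ex_avoiding_all:
  obtains f where "binary f" "\<And>n. fblock n f \<notin> forbidden n"
proof -
  have "[0] \<in> strings (4 ^ 0)" by (simp add: strings_def)
  from extend_avoiding[OF this] that show thesis by (metis le0)
qed

text \<open>A program for \<open>h\<close> ignores its oracle, so it converges on every oracle that
  diagonalisation considers. Only blocks of kind 0 are constrained, which later lets
  \<open>h\<close> be pieced together from members of different classes.\<close>

lemma no_recursive_avoiding:
  fixes h :: "nat \<Rightarrow> nat list"
  assumes "recursive h" "\<And>n. h n \<in> strings (3 * 4 ^ n)" "\<And>n. kind n = 0 \<Longrightarrow> h n \<notin> forbidden n"
  shows False
proof -
  obtain p where p: "\<And>g n. eval g p [n] (encode (h n))"
    using assms(1) unfolding recursive_def encode_nat_def by blast
  show False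
  proof (rule diagonalization[of "index 0 p 0" p "\<lambda>_. 0"])
    show "\<exists>v\<in>strings (3 * 4 ^ index 0 p 0). eval g p [index 0 p 0] (encode v) \<and> v \<notin> forbidden (index 0 p 0)" for g
      using p assms(2,3) by (intro bexI[of _ "h (index 0 p 0)"]) simp_all
  qed (simp_all add: binary_def)
qed

text \<open>A reduction produces single digits, whereas diagonalisation needs a program that on
  input \<open>n\<close> returns the code of the whole block \<open>n\<close>.\<close>

lemma block_program:
  obtains p' where "\<And>g f n. (\<And>k. eval g p [k] (f k)) \<Longrightarrow> eval g p' [n] (encode (fblock n f))"
proof -
  have "decidable (\<lambda>z :: nat list \<times> nat. length (fst z) = 4 ^ Suc (snd z))"
    by (intro recursive_intros)
  moreover have "recursive (\<lambda>z :: nat list \<times> nat. encode (block (snd z) (fst z)))"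
    by (intro recursive_intros)
  ultimately obtain q where q: "\<And>f n w. length (map f [0..<w]) = 4 ^ Suc n \<Longrightarrow>
      (\<And>w'. w' < w \<Longrightarrow> length (map f [0..<w']) \<noteq> 4 ^ Suc n) \<Longrightarrow>
      eval f q [n] (encode (block n (map f [0..<w])))"
    by (rule search_program[of "\<lambda>\<sigma> n. length \<sigma> = 4 ^ Suc n" "\<lambda>\<sigma> n. encode (block n \<sigma>)"]) blast
  have blk: "eval f q [n] (encode (fblock n f))" for f n
    using q[of f "4 ^ Suc n" n] block_map_upt[of n "4 ^ Suc n" f] by (simp del: power_Suc)
  show thesis
    by (rule that[of "replace_oracle p q"], rule eval_replace_oracle[OF blk])
qed

section \<open>Reductions given by programs, and their failure near a common point\<close>

lemma medvedev_leI:
  assumes "\<And>g. g \<in> B \<Longrightarrow> \<exists>f\<in>A. \<forall>n. eval g p [n] (f n)"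
  shows "A \<le>\<^sub>M B"
proof -
  define \<Gamma> where "\<Gamma> g = (if \<exists>f. \<forall>n. eval g p [n] (f n) then Some (THE f. \<forall>n. eval g p [n] (f n)) else None)" for g
  have \<Gamma>: "\<Gamma> g = Some f \<longleftrightarrow> (\<forall>n. eval g p [n] (f n))" for g f
  proof -
    have "(THE f. \<forall>n. eval g p [n] (f n)) = f" if "\<forall>n. eval g p [n] (f n)" for f
      using that eval_deterministic by (intro the_equality ext) blast+
    then show ?thesis unfolding \<Gamma>_def by auto
  qed
  then have "partial_computable \<Gamma>" unfolding partial_computable_def by blast
  with \<Gamma> assms show ?thesis unfolding medvedev_le_def by blast
qed

lemma medvedev_leE:
  assumes "A \<le>\<^sub>M B"
  obtains p where "\<And>g. g \<in> B \<Longrightarrow> \<exists>f\<in>A. \<forall>n. eval g p [n] (f n)"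
  using assms unfolding medvedev_le_def partial_computable_def by metis

lemma fblock_cong: "(\<And>k. k < 4 ^ Suc n \<Longrightarrow> f k = g k) \<Longrightarrow> fblock n f = fblock n g"
  by (simp add: fblock_def)

text \<open>On a block of kind \<open>c\<close> the class \<open>avoiding c\<close> is free while
  \<open>avoiding c'\<close> is bound. Every oracle that copies \<open>f\<close> up to this block
  and avoids all later forbidden contents lies in \<open>avoiding c\<close>, so convergence there is
  exactly what diagonalisation refutes. Padding by \<open>u\<close> keeps the copied part long
  enough.\<close>

lemma no_local_reduction:
  assumes f: "binary f" "\<And>n. fblock n f \<notin> forbidden n" and "c \<noteq> c'"
    and red: "\<And>g. g \<in> avoiding c \<Longrightarrow> (\<And>k. k < u \<Longrightarrow> g k = f k) \<Longrightarrow>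
      \<exists>h\<in>avoiding c'. \<forall>k. eval g p [k] (h k)"
  shows False
proof -
  obtain p' where p': "\<And>g f n. (\<And>k. eval g p [k] (f k)) \<Longrightarrow> eval g p' [n] (encode (fblock n f))"
    using block_program by blast
  define n where "n = index c p' u"
  show False
  proof (rule diagonalization[of n p' f])
    fix g
    assume g: "binary g" "map g [0..<4 ^ n] = map f [0..<4 ^ n]" "\<And>m. n < m \<Longrightarrow> fblock m g \<notin> forbidden m"
    then have gf: "g k = f k" if "k < 4 ^ n" for k
      using that by (simp add: map_upt_0_eq_iff)
    have "fblock m g \<notin> forbidden m" if "kind m \<noteq> c" for m
    proof (cases m n rule: linorder_cases)
      case less
      have "fblock m g = fblock m f"
        using four_power_mono[OF less] by (intro fblock_cong gf) simp
      with f(2) show ?thesis by simp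
    next
      case equal
      with that show ?thesis by (simp add: n_def)
    qed (rule g(3))
    with g(1) have "g \<in> avoiding c" by (simp add: avoiding_def)
    moreover have "g k = f k" if "k < u" for k
      using that le_index[of u c p'] less_four_power[of n 0] by (intro gf) (simp add: n_def)
    ultimately obtain h where h: "h \<in> avoiding c'" "\<And>k. eval g p [k] (h k)"
      using red by blast
    from h(1) assms(3) show "\<exists>v\<in>strings (3 * 4 ^ n). eval g p' [n] (encode v) \<and> v \<notin> forbidden n"
      by (intro bexI[of _ "fblock n h"] conjI p' h(2) fblock_in_strings) (auto simp: avoiding_def n_def)
  qed (use f in \<open>simp_all add: n_def\<close>)
qed

section \<open>The union lies strictly below the direct sum\<close>

lemma union_le_direct_sum: "P \<union> Q \<le>\<^sub>M P \<oplus> Q"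
proof (rule medvedev_leI[of _ _ "Comp Oracle [Succ]"])
  fix g assume "g \<in> P \<oplus> Q"
  then have "(\<lambda>n. g (Suc n)) \<in> P \<union> Q"
    unfolding direct_sum_def by auto
  then show "\<exists>f\<in>P \<union> Q. \<forall>n. eval g (Comp Oracle [Succ]) [n] (f n)"
    by (rule bexI[rotated]) (blast intro: eval_Comp1 eval_Oracle eval_Succ)
qed

text \<open>
  A common point of the two classes is mapped into one of the two summands, and a finite part of
  the oracle already decides which one.
\<close>

lemma not_direct_sum_le_union:
  assumes "c \<noteq> c'"
  shows "\<not> avoiding c \<oplus> avoiding c' \<le>\<^sub>M avoiding c \<union> avoiding c'"
proof
  assume "avoiding c \<oplus> avoiding c' \<le>\<^sub>M avoiding c \<union> avoiding c'"
  then obtain p where p: "\<And>g. g \<in> avoiding c \<union> avoiding c' \<Longrightarrow>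
      \<exists>f\<in>avoiding c \<oplus> avoiding c'. \<forall>n. eval g p [n] (f n)"
    by (rule medvedev_leE) blast
  obtain f where f: "binary f" "\<And>n. fblock n f \<notin> forbidden n"
    by (rule ex_avoiding_all) blast
  then have "f \<in> avoiding c \<union> avoiding c'" by (simp add: avoiding_def)
  with p obtain h where h: "h \<in> avoiding c \<oplus> avoiding c'" "eval f p [0] (h 0)" by blast
  then obtain u where u: "\<And>g. \<forall>k<u. g k = f k \<Longrightarrow> eval g p [0] (h 0)"
    using eval_use by blast
  \<comment> \<open>Dropping the leading digit of the output turns the reduction, near
    \<open>f\<close>, into one to the summand \<open>avoiding d'\<close> that \<open>h 0\<close>
    selects.\<close>
  have shift: "\<exists>h'\<in>avoiding d'. \<forall>k. eval g (Comp p [Succ]) [k] (h' k)"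
    if g: "g \<in> avoiding c \<union> avoiding c'" and gf: "\<And>k. k < u \<Longrightarrow> g k = f k"
      and d': "\<And>h'. h' \<in> avoiding c \<oplus> avoiding c' \<Longrightarrow> h' 0 = h 0 \<Longrightarrow> \<exists>f'\<in>avoiding d'. h' = [h 0] \<frown> f'"
    for g d'
  proof -
    obtain h' where h': "h' \<in> avoiding c \<oplus> avoiding c'" "\<And>n. eval g p [n] (h' n)"
      using p g by blast
    moreover have "h' 0 = h 0"
      using h'(2) u[of g] gf eval_deterministic by blast
    ultimately obtain f' where "f' \<in> avoiding d'" "h' = [h 0] \<frown> f'"
      using d' by blast
    moreover have "eval g (Comp p [Succ]) [k] (h' (Suc k))" for k
      using h'(2) by (intro eval_Comp1[OF eval_Succ])
    ultimately show ?thesis by (intro bexI[of _ f']) auto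
  qed
  from h(1) consider "h 0 = 0" | "h 0 = 1"
    unfolding direct_sum_def by auto
  then show False
  proof cases
    case 1
    show False
    \<comment> \<open>The oracles are taken from the class opposite to the selected summand: members
      of \<open>avoiding c'\<close> near \<open>f\<close> would compute members of
      \<open>avoiding c\<close>.\<close>
    proof (rule no_local_reduction[OF f, of c' c u "Comp p [Succ]"])
      fix g assume "g \<in> avoiding c'" "\<And>k. k < u \<Longrightarrow> g k = f k"
      then show "\<exists>h\<in>avoiding c. \<forall>k. eval g (Comp p [Succ]) [k] (h k)"
        by (intro shift) (auto simp: direct_sum_def 1)
    qed (use assms in simp)
  next
    case 2
    show False
    proof (rule no_local_reduction[OF f, of c c' u "Comp p [Succ]"])
      fix g assume "g \<in> avoiding c" "\<And>k. k < u \<Longrightarrow> g k = f k"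
      then show "\<exists>h\<in>avoiding c'. \<forall>k. eval g (Comp p [Succ]) [k] (h k)"
        by (intro shift) (auto simp: direct_sum_def 2)
    qed (use assms in simp)
  qed
qed


section \<open>Concatenation\<close>

lemma computable_treeD:
  assumes "computable_tree T"
  shows "\<And>\<sigma>. \<sigma> \<in> T \<Longrightarrow> set \<sigma> \<subseteq> {0, 1}"
    and "\<And>\<sigma> \<tau>. \<sigma> \<in> T \<Longrightarrow> Sublist.prefix \<tau> \<sigma> \<Longrightarrow> \<tau> \<in> T"
    and "decidable (\<lambda>\<sigma>. \<sigma> \<in> T)"
  using assms unfolding computable_tree_def computable_strings_iff_decidable by blast+

text \<open>Prefix closure reduces all proper extensions to the two by one digit, which makes being
  a leaf decidable.\<close>

lemma mem_leaves_iff: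
  assumes "computable_tree T"
  shows "\<rho> \<in> leaves T \<longleftrightarrow> \<rho> \<in> T \<and> \<rho> @ [0] \<notin> T \<and> \<rho> @ [1] \<notin> T"
proof
  assume "\<rho> \<in> T \<and> \<rho> @ [0] \<notin> T \<and> \<rho> @ [1] \<notin> T"
  moreover have "\<rho> @ [0] \<in> T \<or> \<rho> @ [1] \<in> T" if mem: "\<tau> \<in> T" and pre: "strict_prefix \<rho> \<tau>" for \<tau>
  proof -
    obtain b zs where \<tau>: "\<tau> = \<rho> @ b # zs" using pre by (rule strict_prefixE')
    then have "\<rho> @ [b] \<in> T" using computable_treeD(2)[OF assms mem, of "\<rho> @ [b]"] by simp
    moreover have "b \<in> {0, 1}" using computable_treeD(1)[OF assms mem] by (simp add: \<tau>)
    ultimately show ?thesis by auto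
  qed
  ultimately show "\<rho> \<in> leaves T" unfolding leaves_def by blast
qed (auto simp: leaves_def strict_prefix_def)

text \<open>Otherwise a greedy walk up the tree would be a recursive member of the class.\<close>

lemma ex_leaf_above:
  assumes T: "computable_tree T" and sub: "paths T \<subseteq> avoiding c" and "c \<noteq> 0" and \<sigma>: "\<sigma> \<in> T"
  shows "\<exists>\<rho>\<in>leaves T. Sublist.prefix \<sigma> \<rho>"
proof (rule ccontr)
  assume no_leaf: "\<not> ?thesis"
  define e where "e = rec_nat \<sigma> (\<lambda>_ \<tau>. if \<tau> @ [0] \<in> T then \<tau> @ [0] else \<tau> @ [1])"
  have e_Suc: "e (Suc j) = (if e j @ [0] \<in> T then e j @ [0] else e j @ [1])" for j
    by (simp add: e_def)
  have len: "length (e j) = length \<sigma> + j" for j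
    by (induction j) (simp_all add: e_Suc, simp add: e_def)
  have e: "e j \<in> T \<and> Sublist.prefix \<sigma> (e j)" for j
  proof (induction j)
    case (Suc j)
    then have "e j \<notin> leaves T" using no_leaf by blast
    with Suc show ?case by (auto simp: mem_leaves_iff[OF T] e_Suc)
  qed (simp add: e_def \<sigma>)
  have mono: "Sublist.prefix (e i) (e j)" if "i \<le> j" for i j
    using that by (induction rule: dec_induct) (auto simp: e_Suc intro: prefix_order.trans)
  define f where "f k = nth_default0 (e (Suc k)) k" for k
  have "map f [0..<t] = take t (e t)" for t
  proof (rule nth_equalityI)
    fix k assume "k < length (map f [0..<t])"
    then have k: "k < t" by simp
    obtain \<rho> where "e t = e (Suc k) @ \<rho>" using mono[of "Suc k" t] k by (auto simp: prefix_def)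
    with k show "map f [0..<t] ! k = take t (e t) ! k"
      by (simp add: f_def len nth_append)
  qed (simp add: len)
  moreover have "take t (e t) \<in> T" for t
    using computable_treeD(2)[OF T] e[of t] take_is_prefix by blast
  ultimately have "f \<in> paths T" by (simp add: paths_iff)
  with sub have f: "f \<in> avoiding c" by blast
  have dec: "decidable (\<lambda>x :: nat \<times> nat list \<times> nat. fst (snd x) @ [0] \<in> T)"
    by (rule decidable_comp[OF computable_treeD(3)[OF T]]) (intro recursive_intros)
  have rec_e: "recursive e"
    unfolding e_def by (intro recursive_intros dec)
  have "recursive f"
    unfolding f_def by (intro recursive_intros recursive_comp[OF rec_e])
  then have "recursive (\<lambda>n. fblock n f)"
    unfolding fblock_def by (intro recursive_intros recursive_comp[OF \<open>recursive f\<close>])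
  then show False
    by (rule no_recursive_avoiding) (use f \<open>c \<noteq> 0\<close> in \<open>auto simp: avoiding_def fblock_in_strings\<close>)
qed

text \<open>Digits copied from \<open>g\<close> before it leaves \<open>T\<close> form a string of
  \<open>T\<close>, hence a prefix of some leaf. The output can still be completed to that leaf,
  after which \<open>g\<close> is copied again from its beginning; it lies in \<open>Q\<close>
  because it is not a path of \<open>T\<close>.\<close>

lemma concatenation_le_union:
  assumes T: "computable_tree T" and ne: "paths T \<noteq> {}"
    and leaf: "\<And>\<sigma>. \<sigma> \<in> T \<Longrightarrow> \<exists>\<rho>\<in>leaves T. Sublist.prefix \<sigma> \<rho>"
  shows "paths T \<union> (\<Union>\<rho>\<in>leaves T. (\<lambda>f. \<rho> \<frown> f) ` Q) \<le>\<^sub>M paths T \<union> Q"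
proof -
  note treeD = computable_treeD[OF T]
  have Nil: "[] \<in> T"
    using ne unfolding paths_iff[abs_def] by (metis all_not_in_conv paths_iff list.map(1) upt_0)
  \<comment> \<open>The implication makes the search for a leaf total: outside \<open>T\<close>
    every number qualifies.\<close>
  define isleaf where "isleaf r \<tau> \<longleftrightarrow> \<tau> \<in> T \<longrightarrow>
    (decode r \<in> T \<and> decode r @ [0] \<notin> T \<and> decode r @ [1] \<notin> T) \<and> take (length \<tau>) (decode r) = \<tau>" for r and \<tau> :: "nat list"
  define leaf_of where "leaf_of \<tau> = (decode (LEAST r. isleaf r \<tau>) :: nat list)" for \<tau>
  have ex: "\<exists>r. isleaf r \<tau>" for \<tau>
  proof (cases "\<tau> \<in> T")
    case True
    from leaf[OF this] obtain \<rho> where "\<rho> \<in> leaves T" "Sublist.prefix \<tau> \<rho>" by blast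
    then have "isleaf (encode \<rho>) \<tau>" by (auto simp: isleaf_def mem_leaves_iff[OF T] prefix_def)
    then show ?thesis ..
  qed (simp add: isleaf_def)
  have leaf_of: "leaf_of \<tau> \<in> leaves T" "take (length \<tau>) (leaf_of \<tau>) = \<tau>" if "\<tau> \<in> T" for \<tau>
    using LeastI_ex[OF ex, of \<tau>] that by (auto simp: isleaf_def leaf_of_def mem_leaves_iff[OF T])
  have mem': "recursive F \<Longrightarrow> decidable (\<lambda>x. F x \<in> T)" for F :: "nat \<times> nat list \<Rightarrow> nat list"
    by (rule decidable_comp[OF treeD(3)])
  have mem: "recursive F \<Longrightarrow> decidable (\<lambda>x. F x \<in> T)" for F :: "nat list \<times> nat \<Rightarrow> nat list"
    by (rule decidable_comp[OF treeD(3)])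
  have rec_leaf: "recursive leaf_of"
    unfolding leaf_of_def
    by (intro recursive_intros recursive_Least ex, unfold isleaf_def) (intro recursive_intros mem')
  \<comment> \<open>For a string outside \<open>T\<close> this is the length of its longest prefix
    in \<open>T\<close>, the empty string being in \<open>T\<close>. The second disjunct only serves
    to make the search total.\<close>
  define exit where "exit \<sigma> = (LEAST m. take (Suc m) \<sigma> \<notin> T \<or> \<sigma> \<in> T)" for \<sigma>
  have "\<exists>m. take (Suc m) \<sigma> \<notin> T \<or> \<sigma> \<in> T" for \<sigma>
    by (rule exI[of _ "length \<sigma>"]) simp
  then have rec_exit: "recursive exit"
    unfolding exit_def by (intro recursive_Least recursive_intros mem')
  define root where "root \<sigma> = leaf_of (take (exit \<sigma>) \<sigma>)" for \<sigma>
  have rec_root: "recursive root"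
    unfolding root_def by (intro recursive_comp[OF rec_leaf] recursive_intros rec_exit)
  \<comment> \<open>Output digit \<open>k\<close> is computed from the first \<open>k + 1\<close>
    digits of \<open>g\<close>. Once they lie outside \<open>T\<close>, their exit point and the
    chosen leaf no longer change with \<open>k\<close>.\<close>
  define U where "U \<sigma> k = (if \<sigma> \<in> T then nth_default0 \<sigma> k
    else if k < length (root \<sigma>) then nth_default0 (root \<sigma>) k
    else nth_default0 \<sigma> (k - length (root \<sigma>)))" for \<sigma> k
  have "recursive (\<lambda>z. U (fst z) (snd z))"
    unfolding U_def by (intro recursive_intros mem recursive_comp[OF rec_root])
  moreover have "decidable (\<lambda>z :: nat list \<times> nat. length (fst z) = Suc (snd z))"
    by (intro recursive_intros)
  ultimately obtain p where "\<And>g k w. length (map g [0..<w]) = Suc k \<Longrightarrow>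
      (\<And>w'. w' < w \<Longrightarrow> length (map g [0..<w']) \<noteq> Suc k) \<Longrightarrow> eval g p [k] (U (map g [0..<w]) k)"
    using search_program[of "\<lambda>\<sigma> k. length \<sigma> = Suc k" U] by blast
  from this[of _ "Suc _"] have p: "eval g p [k] (U (map g [0..<Suc k]) k)" for g k
    by (simp del: upt_Suc)
  show ?thesis
  proof (rule medvedev_leI[of _ _ p])
    fix g assume g: "g \<in> paths T \<union> Q"
    show "\<exists>f\<in>paths T \<union> (\<Union>\<rho>\<in>leaves T. (\<lambda>f. \<rho> \<frown> f) ` Q). \<forall>n. eval g p [n] (f n)"
    proof (cases "g \<in> paths T")
      case True
      then have "U (map g [0..<Suc k]) k = g k" for k
        by (simp add: U_def paths_iff nth_append del: upt_Suc)
      with p[of g] True show ?thesis by (metis UnI1)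
    next
      case False
      then obtain t where "map g [0..<t] \<notin> T" by (auto simp: paths_iff)
      with Nil have ex_m: "\<exists>m. map g [0..<Suc m] \<notin> T" by (cases t) auto
      define m where "m = (LEAST m. map g [0..<Suc m] \<notin> T)"
      have m: "map g [0..<Suc m] \<notin> T" unfolding m_def by (rule LeastI_ex[OF ex_m])
      have below: "map g [0..<Suc k] \<in> T" if "k < m" for k
        using not_less_Least[of k "\<lambda>m. map g [0..<Suc m] \<notin> T"] that unfolding m_def by blast
      have above: "map g [0..<Suc k] \<notin> T" if "m \<le> k" for k
        using m treeD(2)[of "map g [0..<Suc k]"] prefix_map_upt[of "Suc m" "Suc k" g] that by auto
      have "map g [0..<m] \<in> T"
        using below[of "m - 1"] Nil by (cases m) auto
      note \<rho> = leaf_of[OF this]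
      let ?\<rho> = "leaf_of (map g [0..<m])"
      have "m \<le> length ?\<rho>"
        using arg_cong[OF \<rho>(2), of length] by simp
      have exit: "exit (map g [0..<Suc k]) = m" if "m \<le> k" for k
        unfolding exit_def
      proof (rule Least_equality)
        show "take (Suc m) (map g [0..<Suc k]) \<notin> T \<or> map g [0..<Suc k] \<in> T"
          using m that by (simp add: take_map del: upt_Suc)
        fix j assume j: "take (Suc j) (map g [0..<Suc k]) \<notin> T \<or> map g [0..<Suc k] \<in> T"
        show "m \<le> j"
        proof (rule ccontr)
          assume "\<not> m \<le> j"
          with j above[OF that] that below[of j] show False by (simp add: take_map del: upt_Suc)
        qed
      qed
      have "U (map g [0..<Suc k]) k = (?\<rho> \<frown> g) k" for k
      proof (cases "k < m")
        case True
        have "?\<rho> ! k = take m ?\<rho> ! k" using True by simp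
        also have "\<dots> = g k" using \<rho>(2) True by simp
        finally show ?thesis
          using below[OF True] True \<open>m \<le> length ?\<rho>\<close> by (simp add: U_def nth_append del: upt_Suc)
      next
        case False
        then have "root (map g [0..<Suc k]) = ?\<rho>"
          using exit[of k] by (simp add: root_def take_map del: upt_Suc)
        with False above[of k] show ?thesis
          by (simp add: U_def del: upt_Suc)
      qed
      with p[of g] \<rho>(1) g False show ?thesis
        by (intro bexI[of _ "?\<rho> \<frown> g"]) (auto simp del: upt_Suc)
    qed
  qed
qed

text \<open>
  Every string of \<open>T\<close> extends to a member of the concatenation, so a reduction can be run on
  arbitrary strings of \<open>T\<close>; as all kinds of blocks are independent of each other, the values
  found can be combined into a single recursive sequence.
\<close>

lemma not_avoiding_le_concatenation:
  assumes T: "computable_tree T" and ne: "paths T \<noteq> {}" "Q \<noteq> {}" and "c \<noteq> 0" "c' \<noteq> 0"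
    and leaf: "\<And>\<sigma>. \<sigma> \<in> T \<Longrightarrow> \<exists>\<rho>\<in>leaves T. Sublist.prefix \<sigma> \<rho>"
  shows "\<not> avoiding c \<union> avoiding c' \<le>\<^sub>M paths T \<union> (\<Union>\<rho>\<in>leaves T. (\<lambda>f. \<rho> \<frown> f) ` Q)"
    (is "\<not> _ \<le>\<^sub>M ?C")
proof
  assume "avoiding c \<union> avoiding c' \<le>\<^sub>M ?C"
  then obtain p where p: "\<And>g. g \<in> ?C \<Longrightarrow> \<exists>f\<in>avoiding c \<union> avoiding c'. \<forall>n. eval g p [n] (f n)"
    by (rule medvedev_leE) blast
  obtain p' where p': "\<And>g f n. (\<And>k. eval g p [k] (f k)) \<Longrightarrow> eval g p' [n] (encode (fblock n f))"
    using block_program by blast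
  define found where "found w n \<longleftrightarrow> fst (decode w :: nat list \<times> nat \<times> nat list) \<in> T \<and>
    run (fst (decode w :: nat list \<times> nat \<times> nat list)) (fst (snd (decode w :: nat list \<times> nat \<times> nat list)))
      (prog_code p') n (encode (snd (snd (decode w :: nat list \<times> nat \<times> nat list))))" for w n
  define h where "h n = snd (snd (decode (LEAST w. found w n) :: nat list \<times> nat \<times> nat list))" for n
  \<comment> \<open>A path of \<open>T\<close> belongs to the concatenation, so running the
    reduction along it shows that the search terminates.\<close>
  have ex: "\<exists>w. found w n" for n
  proof -
    obtain f where f: "f \<in> paths T" using ne(1) by blast
    then obtain f' where "\<And>n. eval f p [n] (f' n)" using p by blast
    then have "eval f p' [n] (encode (fblock n f'))" by (rule p')
    then obtain u where "run (map f [0..<u]) u (prog_code p') n (encode (fblock n f'))"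
      using run_complete by blast
    with f have "found (encode (map f [0..<u], u, fblock n f')) n"
      by (simp add: found_def paths_iff)
    then show ?thesis ..
  qed
  have dec: "decidable (\<lambda>z :: nat \<times> nat. fst (decode (fst z) :: nat list \<times> nat \<times> nat list) \<in> T)"
    by (rule decidable_comp[OF computable_treeD(3)[OF T]]) (intro recursive_intros)
  have "recursive h"
    unfolding h_def by (intro recursive_intros recursive_Least ex, unfold found_def) (intro recursive_intros dec)
  have h: "h n \<in> strings (3 * 4 ^ n) \<and> (kind n = 0 \<longrightarrow> h n \<notin> forbidden n)" for n
  proof -
    obtain \<sigma> s where \<sigma>: "\<sigma> \<in> T" "run \<sigma> s (prog_code p') n (encode (h n))"
      using LeastI_ex[OF ex, of n] unfolding h_def found_def by blast
    \<comment> \<open>The string found may not extend to a path of \<open>T\<close>; continuing it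
      to a leaf and then by a member of \<open>Q\<close> gives an oracle on which the reduction is
      known to be correct.\<close>
    obtain \<rho> q where \<rho>: "\<rho> \<in> leaves T" "Sublist.prefix \<sigma> \<rho>" "q \<in> Q"
      using leaf[OF \<sigma>(1)] ne(2) by blast
    have "eval (\<rho> \<frown> q) p' [n] (encode (h n))"
    proof (rule run_sound[OF \<sigma>(2)])
      fix k assume "k < length \<sigma>"
      with \<rho>(2) show "(\<rho> \<frown> q) k = \<sigma> ! k" by (auto simp: prefix_def nth_append)
    qed
    moreover obtain f where f: "f \<in> avoiding c \<union> avoiding c'" "\<And>n. eval (\<rho> \<frown> q) p [n] (f n)"
      using p[of "\<rho> \<frown> q"] \<rho> by blast
    ultimately have "h n = fblock n f"
      using p'[OF f(2)] eval_deterministic encode_eq_iff by blast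
    with f(1) assms(4,5) show ?thesis by (auto simp: avoiding_def fblock_in_strings)
  qed
  show False
    by (rule no_recursive_avoiding[OF \<open>recursive h\<close>]) (use h in auto)
qed

theorem corollary7:
  fixes TP :: "(nat \<Rightarrow> nat) set \<Rightarrow> nat list set"
  assumes TP: "\<And>P. Pi01 P \<Longrightarrow> computable_tree (TP P) \<and> paths (TP P) = P"
  shows "\<exists>P Q. Pi01 P \<and> Pi01 Q \<and>
           concatenation TP P Q <\<^sub>M P \<union> Q \<and> P \<union> Q <\<^sub>M P \<oplus> Q"
proof -
  define T where "T = TP (avoiding 1)"
  have T: "computable_tree T" "paths T = avoiding 1"
    using TP[OF Pi01_avoiding] by (simp_all add: T_def)
  obtain f where "binary f" "\<And>n. fblock n f \<notin> forbidden n"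
    by (rule ex_avoiding_all) blast
  then have ne: "avoiding c \<noteq> {}" for c by (auto simp: avoiding_def)
  have leaf: "\<exists>\<rho>\<in>leaves T. Sublist.prefix \<sigma> \<rho>" if "\<sigma> \<in> T" for \<sigma>
    using that T by (intro ex_leaf_above[of T 1]) auto
  have "concatenation TP (avoiding 1) (avoiding 2) <\<^sub>M avoiding 1 \<union> avoiding 2"
    using concatenation_le_union[of T "avoiding 2"] not_avoiding_le_concatenation[of T "avoiding 2" 1 2] T ne leaf
    unfolding medvedev_less_def concatenation_def T_def[symmetric] by simp
  moreover have "avoiding 1 \<union> avoiding 2 <\<^sub>M avoiding 1 \<oplus> avoiding 2"
    unfolding medvedev_less_def using union_le_direct_sum not_direct_sum_le_union[of 1 2] by simp
  ultimately show ?thesis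
    using Pi01_avoiding by blast
qed

end
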